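(* There is an attractive 1-generic degree; that is, there is a 1-generic set $G\in 2^\omega$ whose Turing degree is attractive.
   Context: A set $G\in 2^\omega$ is 1-generic if, for every recursively enumerable set $S$ of finite binary strings, either some initial segment of $G$ lies in $S$, or some initial segment $\rho$ of $G$ has no extension in $S$. A Turing degree is 1-generic if it contains a 1-generic set. Distance on Turing degrees (Hirschfeldt–Jockusch–Schupp). For $A,B\subseteq\omega$ let $\delta(A,B)=\limsup_{n\to\infty}\frac{|(A\triangle B)\cap\{0,\dots,n-1\}|}{n}$ be the upper density of the symmetric difference; this is a pseudometric on the subsets of $\omega$ (and a metric on the classes of sets modulo the relation $\delta(A,B)=0$). For Turing degrees $\mathbf a,\mathbf b$, the distance between $\mathbf a$ and $\mathbf b$ is the Hausdorff distance, with respect to $\delta$, between the families $\{A\subseteq\omega: A\leq_T\mathbf a\}$ and $\{B\subseteq\omega:B\leq_T\mathbf b\}$, namely $$\max\Bigl\{\sup_{A\leq_T\mathbf a}\ \inf_{B\leq_T\mathbf b}\delta(A,B),\ \sup_{B\leq_T\mathbf b}\ \inf_{A\leq_T\mathbf a}\delta(A,B)\Bigr\}.$$ This distance takes only the values $0,\frac12,1$. A Turing degree $\mathbf a$ is attractive if it is at distance $\frac12$ from measure 1 many degrees, i.e. if the set of $Z\in 2^\omega$ such that the distance between $\mathbf a$ and the Turing degree of $Z$ is $\frac12$ has uniform (Lebesgue, fair-coin) measure $1$. *)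

theory Defs
  imports
    "HOL-Probability.Probability"
    "HOL-Library.Nat_Bijection"
    "HOL-Library.Sublist"
begin

section \<open>Oracle computability\<close>

text \<open>Programs for the partial recursive functions relative to an oracle.  A program has no fixed
  arity; \<open>computes X p xs y\<close> says that \<open>p\<close> with oracle \<open>X\<close> converges on
  the argument tuple \<open>xs\<close> with value \<open>y\<close>.  On ill-formed tuples it diverges.\<close>

datatype program =
    Zero
  | Succ
  | Proj nat
  | Oracle
  | Comp program "program list"
  | PrimRec program program
  | Mu program

inductive computes :: "nat set \<Rightarrow> program \<Rightarrow> nat list \<Rightarrow> nat \<Rightarrow> bool" for X :: "nat set" where
  computes_Zero: "computes X Zero xs 0"
| computes_Succ: "computes X Succ [x] (Suc x)"
| computes_Proj: "i < length xs \<Longrightarrow> computes X (Proj i) xs (xs ! i)"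
| computes_Oracle: "computes X Oracle [x] (if x \<in> X then 1 else 0)"
| computes_Comp:
    "list_all2 (\<lambda>q y. computes X q xs y) qs ys \<Longrightarrow> computes X p ys z
      \<Longrightarrow> computes X (Comp p qs) xs z"
| computes_PrimRec_0:
    "computes X p xs y \<Longrightarrow> computes X (PrimRec p q) (0 # xs) y"
| computes_PrimRec_Suc:
    "computes X (PrimRec p q) (n # xs) y \<Longrightarrow> computes X q (n # y # xs) z
      \<Longrightarrow> computes X (PrimRec p q) (Suc n # xs) z"
| computes_Mu:
    "computes X p (n # xs) 0 \<Longrightarrow> \<forall>m<n. \<exists>y. computes X p (m # xs) (Suc y)
      \<Longrightarrow> computes X (Mu p) xs n"

lemma computes_deterministic:
  "computes X p xs y \<Longrightarrow> computes X p xs z \<Longrightarrow> y = z"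
proof (induction arbitrary: z rule: computes.induct)
  case (computes_Comp xs qs ys p w)
  from computes_Comp.prems obtain ys' where ys':
    "list_all2 (\<lambda>q y. computes X q xs y) qs ys'" "computes X p ys' z"
    by (auto elim: computes.cases)
  have "ys = ys'"
    using computes_Comp.IH(1) ys'(1)
    by (auto simp: list_all2_conv_all_nth intro: nth_equalityI)
  with ys' computes_Comp.IH(2) show ?case by blast
next
  case (computes_PrimRec_0 p xs y q)
  from computes_PrimRec_0.prems have "computes X p xs z"
    by (auto elim: computes.cases)
  then show ?case by (rule computes_PrimRec_0.IH)
next
  case (computes_PrimRec_Suc p q n xs y w)
  from computes_PrimRec_Suc.prems obtain y' where
    "computes X (PrimRec p q) (n # xs) y'" "computes X q (n # y' # xs) z"
    by (auto elim: computes.cases)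
  with computes_PrimRec_Suc.IH show ?case by metis
next
  case (computes_Mu p n xs)
  from computes_Mu.prems have z: "computes X p (z # xs) 0"
    "\<forall>m<z. \<exists>y. computes X p (m # xs) (Suc y)"
    by (auto elim: computes.cases)
  show ?case
  proof (rule linorder_cases[of n z])
    assume "n < z"
    with z(2) computes_Mu.IH(1) show ?thesis by blast
  next
    assume "z < n"
    with z(1) computes_Mu.IH(2) show ?thesis by blast
  qed simp
qed (auto elim: computes.cases)

definition turing_reducible :: "nat set \<Rightarrow> nat set \<Rightarrow> bool" (infix \<open>\<le>\<^sub>T\<close> 50) where
  "A \<le>\<^sub>T B \<longleftrightarrow> (\<exists>p. \<forall>n. computes B p [n] (if n \<in> A then 1 else 0))"

text \<open>Replacing oracle queries by a program that answers them.\<close>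

primrec subst_oracle :: "program \<Rightarrow> program \<Rightarrow> program" where
  "subst_oracle r Zero = Zero"
| "subst_oracle r Succ = Succ"
| "subst_oracle r (Proj i) = Proj i"
| "subst_oracle r Oracle = r"
| "subst_oracle r (Comp p qs) = Comp (subst_oracle r p) (map (subst_oracle r) qs)"
| "subst_oracle r (PrimRec p q) = PrimRec (subst_oracle r p) (subst_oracle r q)"
| "subst_oracle r (Mu p) = Mu (subst_oracle r p)"

lemma computes_subst_oracle:
  assumes r: "\<And>n. computes C r [n] (if n \<in> B then 1 else 0)"
  shows "computes B p xs y \<Longrightarrow> computes C (subst_oracle r p) xs y"
proof (induction rule: computes.induct)
  case (computes_Comp xs qs ys p z)
  have "list_all2 (\<lambda>q y. computes C q xs y) (map (subst_oracle r) qs) ys"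
    using computes_Comp.IH(1) by (auto simp: list_all2_conv_all_nth)
  with computes_Comp.IH(2) show ?case by (auto intro: computes.computes_Comp)
next
  case (computes_Mu p n xs)
  then show ?case by (auto intro!: computes.computes_Mu)
qed (auto intro: computes.intros r[simplified] simp: r)

lemma turing_reducible_refl: "A \<le>\<^sub>T A"
  unfolding turing_reducible_def by (blast intro: computes_Oracle)

lemma turing_reducible_trans: "A \<le>\<^sub>T B \<Longrightarrow> B \<le>\<^sub>T C \<Longrightarrow> A \<le>\<^sub>T C"
  unfolding turing_reducible_def by (meson computes_subst_oracle)


section \<open>Turing degrees\<close>

definition turing_equiv :: "(nat set \<times> nat set) set" where
  "turing_equiv = {(A, B). A \<le>\<^sub>T B \<and> B \<le>\<^sub>T A}"

lemma equiv_turing_equiv: "equiv UNIV turing_equiv"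
  by (rule equivI)
    (auto simp: turing_equiv_def refl_on_def sym_def trans_def
      intro: turing_reducible_refl turing_reducible_trans)

definition turing_degree :: "nat set \<Rightarrow> nat set set" where
  "turing_degree A = turing_equiv `` {A}"

definition reducible_to_degree :: "nat set set \<Rightarrow> nat set set" where
  "reducible_to_degree a = {A. \<exists>B\<in>a. A \<le>\<^sub>T B}"

lemma reducible_to_turing_degree: "reducible_to_degree (turing_degree B) = {A. A \<le>\<^sub>T B}"
  by (auto simp: reducible_to_degree_def turing_degree_def turing_equiv_def
      intro: turing_reducible_refl turing_reducible_trans)


section \<open>1-generic sets\<close>

definition string_code :: "bool list \<Rightarrow> nat" where
  "string_code \<sigma> = list_encode (map of_bool \<sigma>)"

text \<open>Domains of partial recursive functions; the empty oracle gives unrelativized computability.\<close>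

definition re_strings :: "bool list set \<Rightarrow> bool" where
  "re_strings S \<longleftrightarrow> (\<exists>p. S = {\<sigma>. \<exists>y. computes {} p [string_code \<sigma>] y})"

definition initial_segment :: "nat set \<Rightarrow> nat \<Rightarrow> bool list" where
  "initial_segment G n = map (\<lambda>i. i \<in> G) [0..<n]"

definition one_generic :: "nat set \<Rightarrow> bool" where
  "one_generic G \<longleftrightarrow>
    (\<forall>S. re_strings S \<longrightarrow>
      (\<exists>n. initial_segment G n \<in> S) \<or>
      (\<exists>n. \<not> (\<exists>\<sigma>\<in>S. prefix (initial_segment G n) \<sigma>)))"


section \<open>Distance between Turing degrees\<close>

text \<open>All distances are taken in \<^typ>\<open>ereal\<close>, a complete lattice, so that suprema, infima and
  upper limits need no boundedness side conditions.\<close>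

definition density_dist :: "nat set \<Rightarrow> nat set \<Rightarrow> ereal" where
  "density_dist A B =
    limsup (\<lambda>n. ereal (real (card (sym_diff A B \<inter> {..<n})) / real n))"

definition family_hausdorff_dist :: "nat set set \<Rightarrow> nat set set \<Rightarrow> ereal" where
  "family_hausdorff_dist \<A> \<B> =
    max (SUP A\<in>\<A>. INF B\<in>\<B>. density_dist A B) (SUP B\<in>\<B>. INF A\<in>\<A>. density_dist A B)"

definition degree_dist :: "nat set set \<Rightarrow> nat set set \<Rightarrow> ereal" where
  "degree_dist a b = family_hausdorff_dist (reducible_to_degree a) (reducible_to_degree b)"


section \<open>Attractive degrees\<close>

definition coin_measure :: "(nat \<Rightarrow> bool) measure" where
  "coin_measure = (\<Pi>\<^sub>M i\<in>UNIV. measure_pmf (bernoulli_pmf (1/2)))"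

text \<open>A point \<open>Z\<close> of Cantor space is identified with the set \<open>{n. Z n}\<close>.  The
  completion makes this Lebesgue measure, so that having measure 1 means containing a Borel set
  of measure 1.\<close>

definition attractive :: "nat set set \<Rightarrow> bool" where
  "attractive a \<longleftrightarrow>
    emeasure (completion coin_measure)
      {Z. degree_dist a (turing_degree {n. Z n}) = ereal (1/2)} = 1"

end

(*
For almost every Z, every B computable from Z must be coarsely approximated within 1/2 by some set
A computable from a 1-generic set G; all other inequalities follow from the strong law of large
numbers, since Z is at distance 1/2 from each of the countably many A computable from G.

Fix a program p and a block of positions.  By Chebyshev, some finite string disagrees on slightly
more than half of the block with p^Z only for few Z, and after finitely many steps most of the
relevant computations have converged.  Choosing the string and the time for each block, the bad
oracles Z form an open set O, most of which is a fixed clopen set.  The rest of O is a union of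
clopen sets D_j whose measures tend to 0 as fast as desired.

G cannot know the times, but it can enumerate codes of the D_j together with a controlled amount of
garbage: every function d is traced by a 1-generic G, in the sense that G enumerates sets T_e of
size at most e + 2 with d(e) in T_e.  Indeed G encodes a claim "d is in T_e" by a run of ones, and
a claim about T_e is only honoured if, since the previous one, G was seen to meet one more of the
first e + 1 recursively enumerable sets.  When building G, meeting the s-th such set may
introduce false claims, but thereafter a fresh claim about T_s is honoured.

With this trace, G searches for a time and a string that work for every oracle not yet covered by
an enumerated clopen set of small measure; the search ends because O is eventually covered, and the
total measure of the garbage is small.
*)
theory Submission
  imports Defs "HOL-Real_Asymp.Real_Asymp"
begin

text \<open>Convergence times themselves cannot be read off a trace: finitely many candidates are
  enumerated, but nothing tells when the enumeration is complete, so no largest candidate can be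
  computed. Covers of the bad oracles survive this defect, since a false member merely adds
  exceptional oracles and is paid for in measure. At level s at most s + 2 clopen sets of measure at
  most 4^-s are believed, which costs at most 2 * 2^-s per level. Levels are pairs of a requirement
  and an index j, and a requirement is a pair (p, k) of a program and a precision; the exceptional
  measure is then summable in k, and by Borel-Cantelli almost every oracle is exceptional for only
  finitely many k. The clopen main part of the bad set and the first block to be treated are finite
  information, which the program for the approximating set may contain as constants. That set thus
  depends on p and k in no uniform way, which suffices for an infimum over all sets computable from
  G.\<close>

section \<open>Closure properties of computable functionals\<close>

text \<open>Argument tuples are given by environments \<open>e\<close>, of which only the first \<open>k\<close> values are
  read; bounded quantifiers and recursion bind new variables at the front of the environment.\<close>

definition computable_in :: "nat set \<Rightarrow> nat \<Rightarrow> ((nat \<Rightarrow> nat) \<Rightarrow> nat) \<Rightarrow> bool" where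
  "computable_in X k f \<longleftrightarrow> (\<exists>p. \<forall>e. computes X p (map e [0..<k]) (f e))"

definition decidable_in :: "nat set \<Rightarrow> nat \<Rightarrow> ((nat \<Rightarrow> nat) \<Rightarrow> bool) \<Rightarrow> bool" where
  "decidable_in X k P \<longleftrightarrow> computable_in X k (\<lambda>e. of_bool (P e))"

named_theorems comp_intros

lemma computable_in_var [comp_intros]: "i < k \<Longrightarrow> computable_in X k (\<lambda>e. e i)"
  unfolding computable_in_def
  by (intro exI[of _ "Proj i"] allI) (use computes_Proj[of i "map e [0..<k]" X for e] in simp)

lemma computable_in_subst:
  assumes "computable_in X n f" and "\<And>i. i < n \<Longrightarrow> computable_in X k (g i)"
  shows "computable_in X k (\<lambda>e. f (\<lambda>i. g i e))"
proof -
  obtain p where p: "\<And>e. computes X p (map e [0..<n]) (f e)"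
    using assms(1) by (auto simp: computable_in_def)
  have "\<forall>i. \<exists>q. i < n \<longrightarrow> (\<forall>e. computes X q (map e [0..<k]) (g i e))"
    using assms(2) by (auto simp: computable_in_def)
  then obtain q where q: "\<And>i e. i < n \<Longrightarrow> computes X (q i) (map e [0..<k]) (g i e)"
    by metis
  have "computes X (Comp p (map q [0..<n])) (map e [0..<k]) (f (\<lambda>i. g i e))" for e
    using p[of "\<lambda>i. g i e"]
    by (rule computes_Comp[rotated]) (auto simp: list_all2_conv_all_nth q)
  then show ?thesis by (auto simp: computable_in_def)
qed

lemma computable_in_subst1:
  assumes "computable_in X 1 (\<lambda>e. F (e 0))" "computable_in X k g"
  shows "computable_in X k (\<lambda>e. F (g e))"
  using computable_in_subst[OF assms(1), of k "\<lambda>i. g"] assms(2) by simp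

lemma computable_in_subst2:
  assumes "computable_in X 2 (\<lambda>e. F (e 0) (e 1))" "computable_in X k g" "computable_in X k h"
  shows "computable_in X k (\<lambda>e. F (g e) (h e))"
  using computable_in_subst[OF assms(1), of k "\<lambda>i. if i = 0 then g else h"] assms(2,3) by simp

lemma decidable_in_subst1:
  assumes "decidable_in X 1 (\<lambda>e. P (e 0))" "computable_in X k g"
  shows "decidable_in X k (\<lambda>e. P (g e))"
  using computable_in_subst1[of X "\<lambda>x. of_bool (P x)"] assms by (simp add: decidable_in_def)

lemma decidable_in_subst2:
  assumes "decidable_in X 2 (\<lambda>e. P (e 0) (e 1))" "computable_in X k g" "computable_in X k h"
  shows "decidable_in X k (\<lambda>e. P (g e) (h e))"
  using computable_in_subst2[of X "\<lambda>x y. of_bool (P x y)"] assms by (simp add: decidable_in_def)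

lemma computable_in_Suc [comp_intros]:
  assumes "computable_in X k f" shows "computable_in X k (\<lambda>e. Suc (f e))"
  by (rule computable_in_subst1[OF _ assms])
    (auto simp: computable_in_def intro!: exI[of _ Succ] computes_Succ)

lemma computable_in_zero: "computable_in X k (\<lambda>e. 0)"
  by (auto simp: computable_in_def intro!: exI[of _ Zero] computes_Zero)

lemma computable_in_const [comp_intros]: "computable_in X k (\<lambda>e. c)"
  by (induction c) (auto intro: computable_in_zero computable_in_Suc)

lemma decidable_in_oracle [comp_intros]:
  assumes "computable_in X k f" shows "decidable_in X k (\<lambda>e. f e \<in> X)"
proof (rule decidable_in_subst1[OF _ assms])
  have "computes X Oracle [x] (of_bool (x \<in> X))" for x
    using computes_Oracle[of X x] by (simp add: of_bool_def)
  then show "decidable_in X 1 (\<lambda>e. e 0 \<in> X)"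
    unfolding decidable_in_def computable_in_def by (intro exI[of _ Oracle]) simp
qed

lemma map_case_nat_upt: "map (case_nat n e) [0..<Suc k] = n # map e [0..<k]"
  by (simp add: map_upt_Suc del: upt_Suc)

lemma computable_in_rec_nat [comp_intros]:
  assumes g: "computable_in X k g"
    and h: "computable_in X (Suc (Suc k)) (\<lambda>e. h (e 0) (e (Suc 0)) (\<lambda>i. e (Suc (Suc i))))"
    and n: "computable_in X k n"
  shows "computable_in X k (\<lambda>e. rec_nat (g e) (\<lambda>i v. h i v e) (n e))"
proof -
  obtain p where p: "\<And>e. computes X p (map e [0..<k]) (g e)"
    using g by (auto simp: computable_in_def)
  obtain q where "\<And>e. computes X q (map e [0..<Suc (Suc k)]) (h (e 0) (e (Suc 0)) (\<lambda>i. e (Suc (Suc i))))"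
    using h unfolding computable_in_def by blast
  from this[of "case_nat i (case_nat v e)" for i v e]
  have q: "computes X q (i # v # map e [0..<k]) (h i v e)" for i v e
    by (simp only: map_case_nat_upt) simp
  have r: "computes X (PrimRec p q) (m # map e [0..<k]) (rec_nat (g e) (\<lambda>i v. h i v e) m)" for m e
    by (induction m) (auto intro: computes_PrimRec_0 computes_PrimRec_Suc p q)
  \<comment> \<open>\<open>PrimRec\<close> recurses on its first argument, so the number of steps is
    first treated as an extra front variable; its actual value \<open>n e\<close> is substituted
    afterwards.\<close>
  let ?f = "\<lambda>e. rec_nat (g (\<lambda>i. e (Suc i))) (\<lambda>j v. h j v (\<lambda>i. e (Suc i))) (e 0)"
  have "computable_in X (Suc k) ?f"
    unfolding computable_in_def
  proof (intro exI allI)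
    fix e :: "nat \<Rightarrow> nat"
    have "map e [0..<Suc k] = e 0 # map (\<lambda>i. e (Suc i)) [0..<k]"
      by (simp add: map_upt_Suc del: upt_Suc)
    then show "computes X (PrimRec p q) (map e [0..<Suc k]) (?f e)"
      using r[of "e 0" "\<lambda>i. e (Suc i)"] by (simp only:)
  qed
  then have "computable_in X k (\<lambda>e. ?f (\<lambda>i. case i of 0 \<Rightarrow> n e | Suc j \<Rightarrow> e j))"
    by (rule computable_in_subst, rename_tac i, case_tac i) (auto intro: n computable_in_var)
  then show ?thesis by simp
qed

lemma computable_in_add [comp_intros]:
  assumes "computable_in X k f" "computable_in X k g"
  shows "computable_in X k (\<lambda>e. f e + g e)"
proof -
  have "rec_nat a (\<lambda>i. Suc) b = a + b" for a b by (induction b) auto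
  moreover have "computable_in X k (\<lambda>e. rec_nat (f e) (\<lambda>i. Suc) (g e))"
    by (intro comp_intros assms) auto
  ultimately show ?thesis by simp
qed

lemma computable_in_mult [comp_intros]:
  assumes "computable_in X k f" "computable_in X k g"
  shows "computable_in X k (\<lambda>e. f e * g e)"
proof -
  have "rec_nat 0 (\<lambda>i v. v + a) b = a * b" for a b :: nat by (induction b) auto
  moreover have "computable_in X 2 (\<lambda>e. rec_nat 0 (\<lambda>i v. v + e 0) (e 1))"
    by (intro comp_intros) auto
  ultimately have "computable_in X 2 (\<lambda>e. e 0 * e 1)" by simp
  from computable_in_subst2[OF this assms] show ?thesis .
qed

lemma computable_in_power [comp_intros]:
  assumes "computable_in X k f" "computable_in X k g"
  shows "computable_in X k (\<lambda>e. f e ^ g e)"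
proof -
  have "rec_nat 1 (\<lambda>i v. v * a) b = a ^ b" for a b :: nat by (induction b) auto
  moreover have "computable_in X 2 (\<lambda>e. rec_nat 1 (\<lambda>i v. v * e 0) (e 1))"
    by (intro comp_intros) auto
  ultimately have "computable_in X 2 (\<lambda>e. e 0 ^ e 1)" by simp
  from computable_in_subst2[OF this assms] show ?thesis .
qed

lemma computable_in_diff [comp_intros]:
  assumes "computable_in X k f" "computable_in X k g"
  shows "computable_in X k (\<lambda>e. f e - g e)"
proof -
  have "rec_nat 0 (\<lambda>i v. i) a = a - 1" for a by (cases a) auto
  moreover have "computable_in X 1 (\<lambda>e. rec_nat 0 (\<lambda>i v. i) (e 0))"
    by (intro comp_intros) auto
  ultimately have "computable_in X 1 (\<lambda>e. e 0 - 1)" by simp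
  note pred = computable_in_subst1[OF this]
  have "rec_nat a (\<lambda>i v. v - 1) b = a - b" for a b :: nat by (induction b) auto
  moreover have "computable_in X k (\<lambda>e. rec_nat (f e) (\<lambda>i v. v - 1) (g e))"
    by (intro comp_intros assms pred) auto
  ultimately show ?thesis by simp
qed

lemma computable_in_of_bool [comp_intros]:
  "decidable_in X k P \<Longrightarrow> computable_in X k (\<lambda>e. of_bool (P e))"
  by (simp add: decidable_in_def)

lemma decidable_in_eq0:
  assumes "computable_in X k f" shows "decidable_in X k (\<lambda>e. f e = 0)"
proof -
  have "of_bool (f e = 0) = 1 - f e" for e by (cases "f e") auto
  then show ?thesis
    unfolding decidable_in_def by (simp del: One_nat_def) (intro comp_intros assms)
qed

lemma decidable_in_le [comp_intros]:
  assumes "computable_in X k f" "computable_in X k g"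
  shows "decidable_in X k (\<lambda>e. f e \<le> g e)"
  using decidable_in_eq0[OF computable_in_diff[OF assms]] by simp

lemma decidable_in_less [comp_intros]:
  assumes "computable_in X k f" "computable_in X k g"
  shows "decidable_in X k (\<lambda>e. f e < g e)"
  using decidable_in_le[OF computable_in_Suc[OF assms(1)] assms(2)] by (simp add: Suc_le_eq)

lemma decidable_in_not [comp_intros]:
  "decidable_in X k P \<Longrightarrow> decidable_in X k (\<lambda>e. \<not> P e)"
  using decidable_in_eq0[of X k "\<lambda>e. of_bool (P e)"] by (simp add: decidable_in_def)

lemma decidable_in_conj [comp_intros]:
  assumes "decidable_in X k P" "decidable_in X k Q"
  shows "decidable_in X k (\<lambda>e. P e \<and> Q e)"
  using computable_in_mult[OF assms[unfolded decidable_in_def]]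
  by (simp add: decidable_in_def of_bool_conj)

lemma decidable_in_disj [comp_intros]:
  assumes "decidable_in X k P" "decidable_in X k Q"
  shows "decidable_in X k (\<lambda>e. P e \<or> Q e)"
  using decidable_in_not[OF decidable_in_conj[OF assms[THEN decidable_in_not]]] by simp

lemma decidable_in_imp [comp_intros]:
  assumes "decidable_in X k P" "decidable_in X k Q"
  shows "decidable_in X k (\<lambda>e. P e \<longrightarrow> Q e)"
  unfolding imp_conv_disj by (intro decidable_in_disj decidable_in_not assms)

lemma decidable_in_iff [comp_intros]:
  assumes "decidable_in X k P" "decidable_in X k Q"
  shows "decidable_in X k (\<lambda>e. P e \<longleftrightarrow> Q e)"
  unfolding iff_conv_conj_imp by (intro decidable_in_conj decidable_in_imp assms)

lemma decidable_in_eq [comp_intros]: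
  assumes "computable_in X k f" "computable_in X k g"
  shows "decidable_in X k (\<lambda>e. f e = g e)"
  using decidable_in_conj[OF decidable_in_le[OF assms] decidable_in_le[OF assms(2,1)]]
  by (simp add: order_eq_iff)

text \<open>One primitive recursion adds up truth values. Bounded quantifiers are reduced to such
  counts, and the error counts on blocks have this form too.\<close>

lemma computable_in_card [comp_intros]:
  assumes P: "decidable_in X (Suc k) (\<lambda>e. P (e 0) (\<lambda>i. e (Suc i)))"
    and f: "computable_in X k f"
  shows "computable_in X k (\<lambda>e. card {i. i < f e \<and> P i e})"
proof -
  have "{i. i < Suc n \<and> Q i} = (if Q n then insert n {i. i < n \<and> Q i} else {i. i < n \<and> Q i})"
    for n and Q :: "nat \<Rightarrow> bool" by (auto simp: less_Suc_eq)
  then have eq: "rec_nat 0 (\<lambda>i v. v + of_bool (Q i)) n = card {i. i < n \<and> Q i}"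
    for n and Q :: "nat \<Rightarrow> bool" by (induction n) auto
  \<comment> \<open>In the recursion step the accumulator sits at place 1 of the environment, so P
    has to be re-indexed around it.\<close>
  have "decidable_in X (Suc (Suc k)) (\<lambda>e. P (e 0) (\<lambda>i. e (Suc (Suc i))))"
    unfolding decidable_in_def
    by (rule computable_in_subst[OF P[unfolded decidable_in_def],
          of "Suc (Suc k)" "\<lambda>i e. case i of 0 \<Rightarrow> e 0 | Suc j \<Rightarrow> e (Suc (Suc j))", simplified])
      (rename_tac i, case_tac i, auto intro: computable_in_var)
  then have "computable_in X k (\<lambda>e. rec_nat 0 (\<lambda>i v. v + of_bool (P i e)) (f e))"
    by (intro comp_intros f) auto
  then show ?thesis by (simp add: eq)
qed

lemma decidable_in_ex [comp_intros]:
  assumes P: "decidable_in X (Suc k) (\<lambda>e. P (e 0) (\<lambda>i. e (Suc i)))"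
    and f: "computable_in X k f"
  shows "decidable_in X k (\<lambda>e. \<exists>i<f e. P i e)"
proof -
  have "decidable_in X k (\<lambda>e. \<not> card {i. i < f e \<and> P i e} = 0)"
    by (intro comp_intros assms)
  then show ?thesis by simp
qed

lemma decidable_in_all [comp_intros]:
  assumes P: "decidable_in X (Suc k) (\<lambda>e. P (e 0) (\<lambda>i. e (Suc i)))"
    and f: "computable_in X k f"
  shows "decidable_in X k (\<lambda>e. \<forall>i<f e. P i e)"
  using decidable_in_not[OF decidable_in_ex[OF decidable_in_not[OF P] f]] by simp

lemma computable_in_Least [comp_intros]:
  assumes P: "decidable_in X (Suc k) (\<lambda>e. P (e 0) (\<lambda>i. e (Suc i)))"
    and ex: "\<And>e. \<exists>i. P i e"
  shows "computable_in X k (\<lambda>e. LEAST i. P i e)"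
proof -
  \<comment> \<open>\<open>Mu\<close> looks for a zero, so the program has to decide the negation of
    P.\<close>
  obtain p where "\<And>e. computes X p (map e [0..<Suc k]) (of_bool (\<not> P (e 0) (\<lambda>i. e (Suc i))))"
    using decidable_in_not[OF P] unfolding decidable_in_def computable_in_def by blast
  from this[of "case_nat i e" for i e]
  have p: "computes X p (i # map e [0..<k]) (of_bool (\<not> P i e))" for i e
    by (simp only: map_case_nat_upt) simp
  have "computes X (Mu p) (map e [0..<k]) (LEAST i. P i e)" for e
  proof (rule computes_Mu)
    show "computes X p ((LEAST i. P i e) # map e [0..<k]) 0"
      using p[of "LEAST i. P i e" e] LeastI_ex[OF ex] by simp
    show "\<forall>m<(LEAST i. P i e). \<exists>y. computes X p (m # map e [0..<k]) (Suc y)"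
    proof (intro allI impI exI)
      fix m assume "m < (LEAST i. P i e)"
      then have "\<not> P m e" by (rule not_less_Least)
      then show "computes X p (m # map e [0..<k]) (Suc 0)" using p[of m e] by simp
    qed
  qed
  then show ?thesis by (auto simp: computable_in_def)
qed

lemma turing_reducible_of_decidable:
  assumes "decidable_in X 1 (\<lambda>e. e 0 \<in> A)"
  shows "A \<le>\<^sub>T X"
proof -
  obtain p where "\<And>e. computes X p (map e [0..<1]) (of_bool (e 0 \<in> A))"
    using assms unfolding decidable_in_def computable_in_def by blast
  from this[of "\<lambda>_. n" for n] have "computes X p [n] (if n \<in> A then 1 else 0)" for n
    by (simp add: of_bool_def)
  then show ?thesis unfolding turing_reducible_def by blast
qed

section \<open>Pairs, lists and finite sets as numbers\<close>

lemma computable_in_prod_encode [comp_intros]: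
  assumes "computable_in X k f" "computable_in X k g"
  shows "computable_in X k (\<lambda>e. prod_encode (f e, g e))"
proof -
  have "rec_nat 0 (\<lambda>i v. v + Suc i) n = triangle n" for n by (induction n) auto
  moreover have "computable_in X 1 (\<lambda>e. rec_nat 0 (\<lambda>i v. v + Suc i) (e 0))"
    by (intro comp_intros) auto
  ultimately have "computable_in X 1 (\<lambda>e. triangle (e 0))" by simp
  note triangle = computable_in_subst1[OF this]
  show ?thesis
    unfolding prod_encode_def prod.case by (intro comp_intros triangle assms)
qed

lemma computable_in_fst_decode [comp_intros]:
  assumes "computable_in X k f" shows "computable_in X k (\<lambda>e. fst (prod_decode (f e)))"
proof (rule computable_in_subst1[OF _ assms])
  have "(LEAST a. \<exists>b<Suc n. prod_encode (a, b) = n) = fst (prod_decode n)" for n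
  proof (rule Least_equality)
    show "\<exists>b<Suc n. prod_encode (fst (prod_decode n), b) = n"
      by (rule exI[of _ "snd (prod_decode n)"])
        (use le_prod_encode_2[of "snd (prod_decode n)" "fst (prod_decode n)"] in simp)
  qed (use prod_encode_inverse in force)
  moreover have "computable_in X 1 (\<lambda>e. LEAST a. \<exists>b<Suc (e 0). prod_encode (a, b) = e 0)"
  proof (intro comp_intros)
    fix e :: "nat \<Rightarrow> nat"
    show "\<exists>a b. b < Suc (e 0) \<and> prod_encode (a, b) = e 0"
      using le_prod_encode_2[of "snd (prod_decode (e 0))" "fst (prod_decode (e 0))"]
      by (intro exI[of _ "fst (prod_decode (e 0))"] exI[of _ "snd (prod_decode (e 0))"]) simp
  qed auto
  ultimately show "computable_in X 1 (\<lambda>e. fst (prod_decode (e 0)))" by simp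
qed

lemma computable_in_snd_decode [comp_intros]:
  assumes "computable_in X k f" shows "computable_in X k (\<lambda>e. snd (prod_decode (f e)))"
proof (rule computable_in_subst1[OF _ assms])
  have "(LEAST b. prod_encode (fst (prod_decode n), b) = n) = snd (prod_decode n)" for n
    by (rule Least_equality) (simp, metis prod_encode_inverse snd_conv order_refl)
  moreover have "computable_in X 1 (\<lambda>e. LEAST b. prod_encode (fst (prod_decode (e 0)), b) = e 0)"
  proof (intro comp_intros)
    fix e :: "nat \<Rightarrow> nat"
    show "\<exists>b. prod_encode (fst (prod_decode (e 0)), b) = e 0"
      by (intro exI[of _ "snd (prod_decode (e 0))"]) simp
  qed auto
  ultimately show "computable_in X 1 (\<lambda>e. snd (prod_decode (e 0)))" by simp
qed

text \<open>The predecessor undoes the \<open>Suc\<close> in the code of a nonempty list. Since 0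
  decodes to the pair (0, 0), the code 0 of the empty list is a fixed point, so that
  \<open>drop_code c i = 0\<close> tests whether the list has at most i entries.\<close>

definition drop_code :: "nat \<Rightarrow> nat \<Rightarrow> nat" where
  "drop_code c i = rec_nat c (\<lambda>_ v. snd (prod_decode (v - 1))) i"

definition nth_code :: "nat \<Rightarrow> nat \<Rightarrow> nat" where
  "nth_code c i = fst (prod_decode (drop_code c i - 1))"

lemma drop_code_list_encode: "drop_code (list_encode xs) i = list_encode (drop i xs)"
proof (induction i)
  case (Suc i)
  have "prod_decode 0 = (0, 0)" using prod_encode_inverse[of "(0,0)"] by (simp add: prod_encode_def)
  with Suc show ?case
    by (cases "drop i xs") (auto simp: drop_code_def drop_Suc simp flip: tl_drop)
qed (simp add: drop_code_def)

lemma nth_code_list_encode: "i < length xs \<Longrightarrow> nth_code (list_encode xs) i = xs ! i"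
  by (simp add: nth_code_def drop_code_list_encode flip: Cons_nth_drop_Suc)

lemma list_encode_eq_0_iff [simp]: "list_encode xs = 0 \<longleftrightarrow> xs = []"
  by (cases xs) auto

lemma drop_code_list_encode_eq_0 [simp]: "drop_code (list_encode xs) i = 0 \<longleftrightarrow> length xs \<le> i"
  by (simp add: drop_code_list_encode)

lemma computable_in_drop_code [comp_intros]:
  assumes "computable_in X k f" "computable_in X k g"
  shows "computable_in X k (\<lambda>e. drop_code (f e) (g e))"
  unfolding drop_code_def by (intro comp_intros assms) auto

lemma computable_in_nth_code [comp_intros]:
  assumes "computable_in X k f" "computable_in X k g"
  shows "computable_in X k (\<lambda>e. nth_code (f e) (g e))"
  unfolding nth_code_def by (intro comp_intros assms)

lemma length_le_list_encode: "length xs \<le> list_encode xs"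
  by (induction xs) (auto intro: le_trans[OF _ le_prod_encode_2])

text \<open>Digit x of z is 1 exactly when z = a * 2^(x+1) + 2^x + b with b < 2^x; this form needs
  bounded search but no division.\<close>

lemma decidable_in_set_decode [comp_intros]:
  assumes "computable_in X k f" "computable_in X k g"
  shows "decidable_in X k (\<lambda>e. f e \<in> set_decode (g e))"
proof -
  have "(\<exists>a<Suc z. \<exists>b<2 ^ x. z = a * 2 ^ Suc x + 2 ^ x + b) \<longleftrightarrow> x \<in> set_decode z" for x z
  proof
    assume "\<exists>a<Suc z. \<exists>b<2 ^ x. z = a * 2 ^ Suc x + 2 ^ x + b"
    then obtain a b where ab: "b < 2 ^ x" "z = (2 * a + 1) * 2 ^ x + b" by (auto simp: algebra_simps)
    then have "z div 2 ^ x = 2 * a + 1"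
      by (simp only: div_mult_self3[of "2 ^ x"]) simp
    then show "x \<in> set_decode z" by (simp add: set_decode_def)
  next
    assume "x \<in> set_decode z"
    then have "odd (z div 2 ^ x)" by (simp add: set_decode_def)
    then obtain a where a: "z div 2 ^ x = 2 * a + 1" by (elim oddE)
    have "z = (z div 2 ^ x) * 2 ^ x + z mod 2 ^ x" by (rule div_mult_mod_eq[symmetric])
    then have z: "z = a * 2 ^ Suc x + 2 ^ x + z mod 2 ^ x" unfolding a by (simp add: algebra_simps)
    moreover have "a < Suc z"
    proof -
      have "a \<le> z div 2 ^ x" using a by simp
      also have "\<dots> \<le> z" by simp
      finally show ?thesis by simp
    qed
    moreover have "z mod 2 ^ x < 2 ^ x" by simp
    ultimately show "\<exists>a<Suc z. \<exists>b<2 ^ x. z = a * 2 ^ Suc x + 2 ^ x + b" by blast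
  qed
  moreover have "decidable_in X 2 (\<lambda>e. \<exists>a<Suc (e 1). \<exists>b<2 ^ e 0. e 1 = a * 2 ^ Suc (e 0) + 2 ^ e 0 + b)"
    by (intro comp_intros) auto
  ultimately have "decidable_in X 2 (\<lambda>e. e 0 \<in> set_decode (e 1))" by simp
  from decidable_in_subst2[of X "\<lambda>x z. x \<in> set_decode z", OF this assms] show ?thesis .
qed

section \<open>Arithmetization of oracle computations by derivations with a time bound\<close>

section \<open>Step-bounded computations\<close>

fun program_code :: "program \<Rightarrow> nat" where
  "program_code Zero = prod_encode (0, 0)"
| "program_code Succ = prod_encode (1, 0)"
| "program_code (Proj i) = prod_encode (2, i)"
| "program_code Oracle = prod_encode (3, 0)"
| "program_code (Comp p qs) =
    prod_encode (4, prod_encode (program_code p, list_encode (map program_code qs)))"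
| "program_code (PrimRec p q) = prod_encode (5, prod_encode (program_code p, program_code q))"
| "program_code (Mu p) = prod_encode (6, program_code p)"

text \<open>The number of the claim that the program with code a, applied to the argument list with
  code x, yields y.\<close>

definition judgement :: "nat \<Rightarrow> nat \<Rightarrow> nat \<Rightarrow> nat" where
  "judgement a x y = prod_encode (a, prod_encode (x, y))"

lemma judgement_inject [simp]: "judgement a x y = judgement a' x' y' \<longleftrightarrow> a = a' \<and> x = x' \<and> y = y'"
  by (simp add: judgement_def)

text \<open>The disjuncts are the rules of \<^const>\<open>computes\<close> on codes.  All witnesses and oracle queries
  are bounded by \<open>t\<close>, so that the relation is decidable and depends only on the oracle below \<open>t\<close>.\<close>

definition derivation_step :: "nat \<Rightarrow> nat set \<Rightarrow> nat set \<Rightarrow> nat \<Rightarrow> nat \<Rightarrow> nat \<Rightarrow> bool" where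
  "derivation_step t Z S a x y \<longleftrightarrow>
    a = prod_encode (0, 0) \<and> y = 0 \<or>
    a = prod_encode (1, 0) \<and> drop_code x 0 \<noteq> 0 \<and> drop_code x 1 = 0 \<and> y = Suc (nth_code x 0) \<or>
    (\<exists>i<t. a = prod_encode (2, i) \<and> drop_code x i \<noteq> 0 \<and> y = nth_code x i) \<or>
    a = prod_encode (3, 0) \<and> drop_code x 0 \<noteq> 0 \<and> drop_code x 1 = 0 \<and> nth_code x 0 < t
      \<and> y = of_bool (nth_code x 0 \<in> Z) \<or>
    (\<exists>b<t. \<exists>l<t. \<exists>w<t. a = prod_encode (4, prod_encode (b, l)) \<and> judgement b w y \<in> S \<and>
      (\<forall>i<Suc l. (drop_code l i = 0 \<longleftrightarrow> drop_code w i = 0) \<and>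
        (drop_code l i \<noteq> 0 \<longrightarrow> judgement (nth_code l i) x (nth_code w i) \<in> S))) \<or>
    (\<exists>b<t. \<exists>g<t. \<exists>w<t. a = prod_encode (5, prod_encode (b, g)) \<and> x = Suc (prod_encode (0, w))
      \<and> judgement b w y \<in> S) \<or>
    (\<exists>b<t. \<exists>g<t. \<exists>n<t. \<exists>w<t. \<exists>v<t. a = prod_encode (5, prod_encode (b, g))
      \<and> x = Suc (prod_encode (Suc n, w)) \<and> judgement a (Suc (prod_encode (n, w))) v \<in> S
      \<and> judgement g (Suc (prod_encode (n, Suc (prod_encode (v, w))))) y \<in> S) \<or>
    (\<exists>b<t. a = prod_encode (6, b) \<and> judgement b (Suc (prod_encode (y, x))) 0 \<in> S \<and>
      (\<forall>m<y. \<exists>v<t. judgement b (Suc (prod_encode (m, x))) (Suc v) \<in> S))"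

text \<open>The newest entry stands at the head, so that an entry is justified by entries of its
  tail only.\<close>

primrec derivation :: "nat \<Rightarrow> nat set \<Rightarrow> nat list \<Rightarrow> bool" where
  "derivation t Z [] \<longleftrightarrow> True"
| "derivation t Z (j # js) \<longleftrightarrow>
    (\<exists>a<t. \<exists>x<t. \<exists>y<t. j = judgement a x y \<and> derivation_step t Z (set js) a x y)
    \<and> derivation t Z js"

definition halts :: "nat \<Rightarrow> nat set \<Rightarrow> nat \<Rightarrow> nat \<Rightarrow> nat \<Rightarrow> bool" where
  "halts t Z a x y \<longleftrightarrow>
    (\<exists>c<t. derivation t Z (list_decode c) \<and> judgement a x y \<in> set (list_decode c))"

lemma derivation_step_mono:
  assumes "derivation_step t Z S a x y" "t \<le> t'" "S \<subseteq> S'"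
  shows "derivation_step t' Z S' a x y"
proof -
  have less: "\<And>i. i < t \<Longrightarrow> i < t'" using assms(2) by simp
  show ?thesis
    using assms(1) unfolding derivation_step_def
    by (elim disj_forward) (blast intro: less dest: subsetD[OF assms(3)])+
qed

lemma derivation_mono: "derivation t Z js \<Longrightarrow> t \<le> t' \<Longrightarrow> derivation t' Z js"
  by (induction js) (auto intro: derivation_step_mono less_le_trans)

lemma halts_mono: "halts t Z a x y \<Longrightarrow> t \<le> t' \<Longrightarrow> halts t' Z a x y"
  unfolding halts_def by (meson derivation_mono less_le_trans)

lemma derivation_append:
  "derivation t Z js \<Longrightarrow> derivation t Z ks \<Longrightarrow> derivation t Z (js @ ks)"
  by (induction js) (auto intro: derivation_step_mono)

lemma derivation_cong:
  assumes "Z \<inter> {..<t} = Z' \<inter> {..<t}" shows "derivation t Z js = derivation t Z' js"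
proof -
  have "x \<in> Z \<longleftrightarrow> x \<in> Z'" if "x < t" for x using assms that by blast
  then have eq: "(x < t \<and> y = of_bool (x \<in> Z)) = (x < t \<and> y = of_bool (x \<in> Z'))" for x y :: nat
    by auto
  have "derivation_step t Z S a x y = derivation_step t Z' S a x y" for S a x y
    unfolding derivation_step_def by (simp only: eq)
  then show ?thesis by (induction js) auto
qed

lemma halts_cong: "Z \<inter> {..<t} = Z' \<inter> {..<t} \<Longrightarrow> halts t Z a x y = halts t Z' a x y"
  unfolding halts_def using derivation_cong[of Z t Z'] by simp

lemma computes_of_derivation_step:
  assumes step: "derivation_step t Z S (program_code p) (list_encode xs) y"
    and S: "\<And>p xs y. judgement (program_code p) (list_encode xs) y \<in> S \<Longrightarrow> computes Z p xs y"
  shows "computes Z p xs y"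
proof (cases p)
  case Zero
  with step show ?thesis by (auto simp: derivation_step_def intro: computes_Zero)
next
  case Succ
  with step have "length xs = 1" "y = Suc (xs ! 0)"
    by (auto simp: derivation_step_def nth_code_list_encode le_Suc_eq)
  with Succ show ?thesis by (auto simp: length_Suc_conv intro: computes_Succ)
next
  case (Proj i)
  with step have "i < length xs" "y = xs ! i"
    by (auto simp: derivation_step_def nth_code_list_encode)
  with Proj show ?thesis by (auto intro: computes_Proj)
next
  case Oracle
  with step have "length xs = 1" "y = of_bool (xs ! 0 \<in> Z)"
    by (auto simp: derivation_step_def nth_code_list_encode le_Suc_eq)
  with Oracle show ?thesis using computes_Oracle[of Z "xs ! 0"]
    by (auto simp: length_Suc_conv)
next
  case (Comp q qs)
  let ?l = "list_encode (map program_code qs)"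
  from step obtain b l w where *: "program_code p = prod_encode (4, prod_encode (b, l))"
    "judgement b w y \<in> S"
    "\<forall>i<Suc l. (drop_code l i = 0 \<longleftrightarrow> drop_code w i = 0) \<and>
        (drop_code l i \<noteq> 0 \<longrightarrow> judgement (nth_code l i) (list_encode xs) (nth_code w i) \<in> S)"
    unfolding derivation_step_def by (elim disjE) (simp add: Comp; fail | blast)+
  from *(1) have bl: "b = program_code q" "l = ?l" by (simp_all add: Comp)
  note w = *(2)[unfolded bl] *(3)[unfolded bl, rule_format]
  obtain ws where ws: "w = list_encode ws" by (metis list_decode_inverse)
  \<comment> \<open>The rule compares the ends of the two lists only at positions up to the code of
    the first; as a list is no longer than its code, \<open>length qs\<close> is among them, which
    forces equal lengths.\<close>
  have len: "length qs \<le> ?l" using length_le_list_encode[of "map program_code qs"] by simp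
  have *: "length qs \<le> i \<longleftrightarrow> length ws \<le> i" if "i \<le> ?l" for i
    using w(2)[of i] that by (simp add: ws)
  have "length ws = length qs"
    using *[of "length ws"] *[of "length qs"] len by (metis le_cases order_antisym order_trans order_refl)
  moreover have "computes Z (qs ! i) xs (ws ! i)" if "i < length qs" for i
    using w(2)[of i] that len calculation by (intro S) (simp add: ws nth_code_list_encode)
  ultimately have "list_all2 (\<lambda>q y. computes Z q xs y) qs ws"
    by (auto simp: list_all2_conv_all_nth)
  moreover have "computes Z q ws y" using w(1) ws S by blast
  ultimately show ?thesis unfolding Comp by (rule computes_Comp)
next
  case (PrimRec q r)
  consider w where "list_encode xs = Suc (prod_encode (0, w))" "judgement (program_code q) w y \<in> S"
  | n w v where "list_encode xs = Suc (prod_encode (Suc n, w))"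
      "judgement (program_code p) (Suc (prod_encode (n, w))) v \<in> S"
      "judgement (program_code r) (Suc (prod_encode (n, Suc (prod_encode (v, w))))) y \<in> S"
    using step unfolding PrimRec derivation_step_def by auto
  then show ?thesis
  proof cases
    case 1
    moreover obtain ws where "w = list_encode ws" by (metis list_decode_inverse)
    ultimately have "list_encode xs = list_encode (0 # ws)" and q: "computes Z q ws y"
      by (auto intro: S)
    then have "xs = 0 # ws" by (simp only: list_encode_eq)
    with q show ?thesis unfolding PrimRec by (auto intro: computes_PrimRec_0)
  next
    case 2
    moreover obtain ws where ws: "w = list_encode ws" by (metis list_decode_inverse)
    ultimately have "list_encode xs = list_encode (Suc n # ws)" by simp
    then have xs: "xs = Suc n # ws" by (simp only: list_encode_eq)
    have "computes Z p (n # ws) v" by (rule S) (use 2 ws in simp)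
    moreover have "computes Z r (n # v # ws) y" by (rule S) (use 2 ws in simp)
    ultimately show ?thesis unfolding PrimRec xs by (rule computes_PrimRec_Suc)
  qed
next
  case (Mu q)
  have "judgement (program_code q) (Suc (prod_encode (y, list_encode xs))) 0 \<in> S"
    "\<forall>m<y. \<exists>v. judgement (program_code q) (Suc (prod_encode (m, list_encode xs))) (Suc v) \<in> S"
    using step unfolding Mu derivation_step_def by auto
  then have "computes Z q (y # xs) 0" "\<forall>m<y. \<exists>v. computes Z q (m # xs) (Suc v)"
    by (auto intro!: S) (metis S list_encode.simps(2))
  then show ?thesis unfolding Mu by (rule computes_Mu)
qed

lemma computes_of_derivation:
  "derivation t Z js \<Longrightarrow> judgement (program_code p) (list_encode xs) y \<in> set js
    \<Longrightarrow> computes Z p xs y"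
proof (induction js arbitrary: p xs y)
  case (Cons j js)
  then show ?case by (auto intro: computes_of_derivation_step)
qed simp

lemma computes_of_halts: "halts t Z (program_code p) (list_encode xs) y \<Longrightarrow> computes Z p xs y"
  by (auto simp: halts_def intro: computes_of_derivation)

definition derivable :: "nat set \<Rightarrow> nat \<Rightarrow> bool" where
  "derivable Z j \<longleftrightarrow> (\<exists>t js. derivation t Z js \<and> j \<in> set js)"

text \<open>The finitely many premises get one common derivation by concatenation under the larger
  time bound, and the conclusion is put in front of it.\<close>

lemma derivable_step:
  assumes fin: "finite S" and S: "\<And>j. j \<in> S \<Longrightarrow> derivable Z j"
    and step: "derivation_step t Z S a x y"
  shows "derivable Z (judgement a x y)"
proof -
  have "\<exists>t js. derivation t Z js \<and> S \<subseteq> set js"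
    using fin S
  proof (induction S rule: finite_induct)
    case (insert j S)
    then obtain t js where "derivation t Z js" "S \<subseteq> set js" by auto
    moreover obtain t' js' where "derivation t' Z js'" "j \<in> set js'"
      using insert.prems[of j] by (auto simp: derivable_def)
    ultimately have "derivation (max t t') Z (js @ js')" "insert j S \<subseteq> set (js @ js')"
      by (auto intro!: derivation_append intro: derivation_mono)
    then show ?case by blast
  next
    case empty
    have "derivation 0 Z [] \<and> ({} :: nat set) \<subseteq> set []" by simp
    then show ?case by blast
  qed
  then obtain t' js where js: "derivation t' Z js" "S \<subseteq> set js" by auto
  let ?t = "Suc (t + t' + a + x + y)"
  have "derivation_step ?t Z (set js) a x y"
    by (rule derivation_step_mono[OF step _ js(2)]) simp
  moreover have "derivation ?t Z js" by (rule derivation_mono[OF js(1)]) simp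
  moreover have "a < ?t" "x < ?t" "y < ?t" by auto
  ultimately have "derivation ?t Z (judgement a x y # js)" by auto
  then show ?thesis unfolding derivable_def by (metis list.set_intros(1))
qed

lemma derivable_of_computes:
  "computes Z p xs y \<Longrightarrow> derivable Z (judgement (program_code p) (list_encode xs) y)"
proof (induction rule: computes.induct)
  case (computes_Zero xs)
  show ?case by (rule derivable_step[of "{}" _ 0]) (auto simp: derivation_step_def)
next
  case (computes_Succ x)
  show ?case
    by (rule derivable_step[of "{}" _ 0])
      (auto simp: derivation_step_def nth_code_list_encode simp del: list_encode.simps)
next
  case (computes_Proj i xs)
  then show ?case
    by (intro derivable_step[of "{}" _ "Suc i"]) (auto simp: derivation_step_def nth_code_list_encode)
next
  case (computes_Oracle x)
  then show ?case
    by (intro derivable_step[of "{}" _ "Suc x"])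
      (auto simp: derivation_step_def nth_code_list_encode simp del: list_encode.simps)
next
  case (computes_Comp xs qs ys p z)
  let ?l = "list_encode (map program_code qs)" and ?w = "list_encode ys"
  let ?S = "insert (judgement (program_code p) ?w z)
    ((\<lambda>i. judgement (program_code (qs ! i)) (list_encode xs) (ys ! i)) ` {..<length qs})"
  have len: "length ys = length qs" and
    IH: "\<And>i. i < length qs \<Longrightarrow> derivable Z (judgement (program_code (qs ! i)) (list_encode xs) (ys ! i))"
    using computes_Comp.IH(1) by (auto simp: list_all2_conv_all_nth)
  show ?case
  proof (rule derivable_step[of ?S])
    have mem: "judgement (nth_code ?l i) (list_encode xs) (nth_code ?w i) \<in> ?S" if "i < length qs" for i
      using that by (auto simp: nth_code_list_encode len)
    show "derivation_step (Suc (program_code p + ?l + ?w)) Z ?S (program_code (Comp p qs)) (list_encode xs) z"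
      unfolding derivation_step_def
      apply (rule disjI2, rule disjI2, rule disjI2, rule disjI2, rule disjI1)
      apply (rule exI[of _ "program_code p"], rule conjI, simp)
      apply (rule exI[of _ ?l], rule conjI, simp)
      apply (rule exI[of _ ?w], rule conjI, simp)
      apply (intro conjI)
        apply simp
       apply (rule insertI1)
      apply (use mem in \<open>auto simp: len not_le simp del: insert_iff\<close>)
      done
  qed (use IH computes_Comp.IH(2) in auto)
next
  case (computes_PrimRec_0 p xs y q)
  show ?case
  proof (rule derivable_step)
    show "derivation_step (Suc (program_code p + program_code q + list_encode xs)) Z
      {judgement (program_code p) (list_encode xs) y} (program_code (PrimRec p q)) (list_encode (0 # xs)) y"
      unfolding derivation_step_def by auto
  qed (use computes_PrimRec_0.IH in auto)
next
  case (computes_PrimRec_Suc p q n xs y z)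
  let ?S = "{judgement (program_code (PrimRec p q)) (list_encode (n # xs)) y,
    judgement (program_code q) (list_encode (n # y # xs)) z}"
  show ?case
  proof (rule derivable_step)
    show "derivation_step (Suc (program_code p + program_code q + n + list_encode xs + y)) Z
      ?S (program_code (PrimRec p q)) (list_encode (Suc n # xs)) z"
      unfolding derivation_step_def
      apply (rule disjI2, rule disjI2, rule disjI2, rule disjI2, rule disjI2, rule disjI2, rule disjI1)
      apply (rule exI[of _ "program_code p"], rule conjI, simp)
      apply (rule exI[of _ "program_code q"], rule conjI, simp)
      apply (rule exI[of _ n], rule conjI, simp)
      apply (rule exI[of _ "list_encode xs"], rule conjI, simp)
      apply (rule exI[of _ y])
      apply simp
      done
  qed (use computes_PrimRec_Suc.IH in auto)
next
  case (computes_Mu p n xs)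
  then obtain v where v: "\<And>m. m < n \<Longrightarrow>
      derivable Z (judgement (program_code p) (list_encode (m # xs)) (Suc (v m)))"
    by metis
  let ?S = "insert (judgement (program_code p) (list_encode (n # xs)) 0)
    ((\<lambda>m. judgement (program_code p) (list_encode (m # xs)) (Suc (v m))) ` {..<n})"
  show ?case
  proof (rule derivable_step[of ?S])
    \<comment> \<open>The values at arguments below n are witnesses that the time bound has to
      exceed; their sum takes care of all of them.\<close>
    have mem: "v m < Suc (program_code p + sum v {..<n})" if "m < n" for m
      using member_le_sum[of m "{..<n}" v] that by simp
    show "derivation_step (Suc (program_code p + sum v {..<n})) Z ?S (program_code (Mu p)) (list_encode xs) n"
      unfolding derivation_step_def
      apply (rule disjI2, rule disjI2, rule disjI2, rule disjI2, rule disjI2, rule disjI2, rule disjI2)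
      apply (rule exI[of _ "program_code p"])
      apply (use mem in auto)
      done
  qed (use v computes_Mu.IH in auto)
qed

lemma halts_of_computes:
  assumes "computes Z p xs y"
  shows "\<exists>t. halts t Z (program_code p) (list_encode xs) y"
proof -
  obtain t js where "derivation t Z js" "judgement (program_code p) (list_encode xs) y \<in> set js"
    using derivable_of_computes[OF assms] by (auto simp: derivable_def)
  then have "halts (Suc (t + list_encode js)) Z (program_code p) (list_encode xs) y"
    unfolding halts_def
    by (intro exI[of _ "list_encode js"]) (auto intro: derivation_mono)
  then show ?thesis by blast
qed

lemma derivation_nth:
  "derivation t Z js \<longleftrightarrow> (\<forall>i<length js. \<exists>a<t. \<exists>x<t. \<exists>y<t.
    js ! i = judgement a x y \<and> derivation_step t Z (set (drop (Suc i) js)) a x y)"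
proof (induction js)
  case (Cons j js)
  show ?case by (simp add: Cons.IH All_less_Suc2 del: drop_Suc_Cons add: drop_Suc_Cons)
qed simp

text \<open>Puts derivations into the form accepted by the closure rules: codes instead of lists,
  and all quantifiers bounded. The bound t suffices for positions because a list is no longer than
  its code c, which is below t.\<close>

lemma derivation_list_decode:
  assumes "c < t"
  shows "derivation t Z (list_decode c) \<longleftrightarrow>
    (\<forall>i<t. drop_code c i \<noteq> 0 \<longrightarrow> (\<exists>a<t. \<exists>x<t. \<exists>y<t. nth_code c i = judgement a x y \<and>
      derivation_step t Z {j. \<exists>k<t. i < k \<and> drop_code c k \<noteq> 0 \<and> nth_code c k = j} a x y))"
proof -
  define js where "js = list_decode c"
  have c: "c = list_encode js" by (simp add: js_def)
  have len: "length js < t" using length_le_list_encode[of js] assms c by simp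
  have S: "{j. \<exists>k<t. i < k \<and> drop_code c k \<noteq> 0 \<and> nth_code c k = j} = set (drop (Suc i) js)"
    (is "?L = ?R") for i
  proof (intro equalityI subsetI)
    fix j assume "j \<in> ?L"
    then obtain k where k: "i < k" "k < length js" "js ! k = j"
      by (auto simp: c nth_code_list_encode not_le)
    then have "drop (Suc i) js ! (k - Suc i) = j" "k - Suc i < length (drop (Suc i) js)" by auto
    then show "j \<in> ?R" by (metis nth_mem)
  next
    fix j assume "j \<in> ?R"
    then obtain k where "k < length js - Suc i" "js ! (Suc i + k) = j"
      by (auto simp: in_set_conv_nth)
    then show "j \<in> ?L" using len
      by (auto simp: c nth_code_list_encode not_le intro!: exI[of _ "Suc i + k"])
  qed
  show ?thesis
    unfolding S js_def[symmetric] unfolding derivation_nth c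
    using len by (auto simp: not_le nth_code_list_encode)
qed

text \<open>The oracle is presented as a number coding a finite set. Since \<open>halts\<close> with
  bound t reads the oracle only below t, a statement about all oracles can thus be checked on the
  numbers below 2^t.\<close>

lemma decidable_in_halts [comp_intros]:
  assumes "computable_in X k f0" "computable_in X k f1" "computable_in X k f2"
    "computable_in X k f3" "computable_in X k f4"
  shows "decidable_in X k (\<lambda>e. halts (f0 e) (set_decode (f1 e)) (f2 e) (f3 e) (f4 e))"
proof -
  have mem: "(j \<in> set (list_decode c)) \<longleftrightarrow> (\<exists>i<t. drop_code c i \<noteq> 0 \<and> nth_code c i = j)"
    if "c < t" for c t j
  proof -
    obtain js where c: "c = list_encode js" by (metis list_decode_inverse)
    with that length_le_list_encode[of js] have "length js < t" by simp
    then show ?thesis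
      by (auto simp: c in_set_conv_nth nth_code_list_encode not_le intro: less_trans)
  qed
  have "halts t Z a x y \<longleftrightarrow> (\<exists>c<t. (\<forall>i<t. drop_code c i \<noteq> 0 \<longrightarrow>
     (\<exists>a<t. \<exists>x<t. \<exists>y<t. nth_code c i = judgement a x y \<and>
      derivation_step t Z {j. \<exists>k<t. i < k \<and> drop_code c k \<noteq> 0 \<and> nth_code c k = j} a x y))
     \<and> (\<exists>i<t. drop_code c i \<noteq> 0 \<and> nth_code c i = judgement a x y))" for t Z a x y
    unfolding halts_def by (intro ex_cong1 conj_cong derivation_list_decode mem) auto
  then have "decidable_in X 5 (\<lambda>e. halts (e 0) (set_decode (e 1)) (e 2) (e 3) (e 4))"
    apply (simp only:)
    unfolding derivation_step_def judgement_def mem_Collect_eq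
    apply (intro comp_intros)
                        apply simp_all
    done
  moreover have "computable_in X k ([f0, f1, f2, f3, f4] ! i)" if "i < 5" for i
    using that assms by (auto simp: less_Suc_eq numeral_eq_Suc)
  ultimately show ?thesis
    using computable_in_subst[of X 5 _ k "\<lambda>i. [f0, f1, f2, f3, f4] ! i"]
    unfolding decidable_in_def by fastforce
qed

section \<open>Building a 1-generic set around an arbitrary function\<close>

section \<open>Tracing functions by 1-generic sets\<close>

definition meets_by :: "nat set \<Rightarrow> nat \<Rightarrow> nat \<Rightarrow> bool" where
  "meets_by G j n \<longleftrightarrow>
    (\<exists>l<n. \<exists>y<n. halts n {} j (list_encode [string_code (initial_segment G l)]) y)"

text \<open>The position n is the zero just behind the run of ones. The run is maximal, being
  preceded by a zero or by the beginning of G, so that n determines its length and hence the claim;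
  \<open>Suc\<close> keeps the run nonempty.\<close>

definition marks :: "nat set \<Rightarrow> nat \<Rightarrow> nat \<Rightarrow> nat \<Rightarrow> bool" where
  "marks G n e d \<longleftrightarrow>
    Suc (prod_encode (e, d)) \<le> n \<and> n \<notin> G \<and> (\<forall>i<Suc (prod_encode (e, d)). n - Suc i \<in> G) \<and>
    (Suc (prod_encode (e, d)) < n \<longrightarrow> n - Suc (Suc (prod_encode (e, d))) \<notin> G)"

text \<open>The second conjunct caps the number of honoured marks at level \<open>e\<close> by \<open>e + 2\<close>, whatever
  \<open>G\<close> is, while each newly met set permits a fresh one.\<close>

definition enumerates_at :: "nat set \<Rightarrow> nat \<Rightarrow> nat \<Rightarrow> nat \<Rightarrow> bool" where
  "enumerates_at G n e d \<longleftrightarrow>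
    marks G n e d \<and>
    (\<forall>n'<n. \<forall>d'<n. marks G n' e d' \<longrightarrow> (\<exists>j<Suc e. meets_by G j n \<and> \<not> meets_by G j n'))"

definition trace :: "nat set \<Rightarrow> nat \<Rightarrow> nat set" where
  "trace G e = {d. \<exists>n. enumerates_at G n e d}"

lemma computable_in_initial_segment [comp_intros]:
  assumes "computable_in G k f"
  shows "computable_in G k (\<lambda>e. string_code (initial_segment G (f e)))"
proof (rule computable_in_subst1[OF _ assms])
  have "rec_nat 0 (\<lambda>i v. Suc (prod_encode (of_bool (l - Suc i \<in> G), v))) i =
      list_encode (map (\<lambda>x. of_bool (x \<in> G)) [l - i..<l])" if "i \<le> l" for i l
    using that
  proof (induction i)
    case (Suc i)
    then have "[l - Suc i..<l] = (l - Suc i) # [l - i..<l]"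
      by (subst upt_conv_Cons) (auto simp: Suc_diff_Suc)
    with Suc show ?case by simp
  qed simp
  from this[OF order_refl]
  have "rec_nat 0 (\<lambda>i v. Suc (prod_encode (of_bool (l - Suc i \<in> G), v))) l =
      string_code (initial_segment G l)" for l
    by (simp add: string_code_def initial_segment_def comp_def)
  moreover have "computable_in G 1
      (\<lambda>e. rec_nat 0 (\<lambda>i v. Suc (prod_encode (of_bool (e 0 - Suc i \<in> G), v))) (e 0))"
    by (intro comp_intros) auto
  ultimately show "computable_in G 1 (\<lambda>e. string_code (initial_segment G (e 0)))" by simp
qed

lemma decidable_in_meets_by [comp_intros]:
  assumes "computable_in G k f" "computable_in G k g"
  shows "decidable_in G k (\<lambda>e. meets_by G (f e) (g e))"
proof (rule decidable_in_subst2[OF _ assms])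
  show "decidable_in G 2 (\<lambda>e. meets_by G (e 0) (e 1))"
    unfolding meets_by_def set_decode_zero[symmetric] list_encode.simps
    apply (intro comp_intros)
         apply simp_all
    done
qed

lemma decidable_in_enumerates_at:
  "decidable_in G 3 (\<lambda>e. enumerates_at G (e 0) (e 1) (e 2))"
  unfolding enumerates_at_def marks_def
  apply (intro comp_intros)
                      apply simp_all
  done

lemma meets_by_mono: "meets_by G j n \<Longrightarrow> n \<le> n' \<Longrightarrow> meets_by G j n'"
  unfolding meets_by_def by (meson halts_mono less_le_trans)

text \<open>Of two runs ending at the same zero, the longer would have a one where the shorter has
  its delimiter.\<close>

lemma marks_unique:
  assumes "marks G n e d" "marks G n e' d'" shows "e = e' \<and> d = d'"
proof -
  define c c' where "c = Suc (prod_encode (e, d))" and "c' = Suc (prod_encode (e', d'))"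
  have *: "\<not> c < c'" if "c \<le> n" "c' \<le> n" "\<forall>i<c'. n - Suc i \<in> G" "c < n \<longrightarrow> n - Suc c \<notin> G" for c c'
    using that by fastforce
  have "c = c'"
    using *[of c c'] *[of c' c] assms unfolding marks_def c_def[symmetric] c'_def[symmetric]
    by (metis linorder_neqE_nat)
  then show ?thesis by (simp add: c_def c'_def)
qed

lemma marks_bound: "marks G n e d \<Longrightarrow> d < n"
  unfolding marks_def by (meson Suc_le_lessD le_less_trans le_prod_encode_2)

text \<open>Between two honoured marks at level e the number of met sets with index at most e grows
  strictly. This number lies between 0 and e + 1, so at most e + 2 positions are honoured, and each
  position carries only one mark.\<close>

lemma
  shows finite_trace: "finite (trace G e)" and card_trace_le: "card (trace G e) \<le> e + 2"
proof -
  define N where "N = {n. \<exists>d. enumerates_at G n e d}"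
  define f where "f n = card {j. j < Suc e \<and> meets_by G j n}" for n
  have mono: "f n' < f n" if n: "n' \<in> N" "n \<in> N" "n' < n" for n n'
  proof -
    obtain d d' where d: "enumerates_at G n e d" "enumerates_at G n' e d'"
      using n unfolding N_def by blast
    then have "marks G n' e d'" by (simp add: enumerates_at_def)
    moreover from marks_bound[OF this] n(3) have "d' < n" by simp
    ultimately obtain j where "j < Suc e" "meets_by G j n" "\<not> meets_by G j n'"
      using d(1) n(3) unfolding enumerates_at_def by blast
    then have "{j. j < Suc e \<and> meets_by G j n'} \<subset> {j. j < Suc e \<and> meets_by G j n}"
      using meets_by_mono[of G _ n' n] n(3) by auto
    then show ?thesis unfolding f_def by (intro psubset_card_mono) auto
  qed
  have inj: "inj_on f N" using mono by (metis inj_onI less_irrefl linorder_neqE_nat)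
  have ran: "f ` N \<subseteq> {..Suc e}"
  proof
    fix x assume "x \<in> f ` N"
    moreover have "f n \<le> card {..<Suc e}" for n unfolding f_def by (intro card_mono) auto
    ultimately show "x \<in> {..Suc e}" by auto
  qed
  have fin: "finite N" using inj ran by (meson finite_atMost finite_imageD finite_subset)
  have card: "card N \<le> e + 2"
    using card_inj_on_le[OF inj ran] by simp
  have eq: "trace G e = (\<lambda>n. SOME d. enumerates_at G n e d) ` N"
  proof (intro equalityI subsetI)
    fix d assume "d \<in> trace G e"
    then obtain n where n: "enumerates_at G n e d" by (auto simp: trace_def)
    then have "(SOME d. enumerates_at G n e d) = d"
      by (intro some_equality) (auto simp: enumerates_at_def dest: marks_unique)
    moreover have "n \<in> N" using n by (auto simp: N_def)
    ultimately show "d \<in> (\<lambda>n. SOME d. enumerates_at G n e d) ` N" by (metis imageI)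
  next
    fix d assume "d \<in> (\<lambda>n. SOME d. enumerates_at G n e d) ` N"
    then obtain n where n: "\<exists>d. enumerates_at G n e d" "d = (SOME d. enumerates_at G n e d)"
      by (auto simp: N_def)
    from someI_ex[OF n(1)] show "d \<in> trace G e" unfolding trace_def n(2) by blast
  qed
  show "finite (trace G e)" unfolding eq using fin by simp
  show "card (trace G e) \<le> e + 2" unfolding eq using card_image_le[OF fin] card by (rule order_trans)
qed

definition extends :: "nat set \<Rightarrow> bool list \<Rightarrow> bool" where
  "extends G \<sigma> \<longleftrightarrow> initial_segment G (length \<sigma>) = \<sigma>"

lemma length_initial_segment [simp]: "length (initial_segment G n) = n"
  by (simp add: initial_segment_def)

lemma nth_initial_segment [simp]: "i < n \<Longrightarrow> initial_segment G n ! i \<longleftrightarrow> i \<in> G"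
  by (simp add: initial_segment_def)

lemma extends_iff: "extends G \<sigma> \<longleftrightarrow> (\<forall>i<length \<sigma>. i \<in> G \<longleftrightarrow> \<sigma> ! i)"
proof
  show "extends G \<sigma>" if "\<forall>i<length \<sigma>. i \<in> G \<longleftrightarrow> \<sigma> ! i"
    unfolding extends_def by (rule nth_equalityI) (use that in simp_all)
  show "\<forall>i<length \<sigma>. i \<in> G \<longleftrightarrow> \<sigma> ! i" if "extends G \<sigma>"
    using that unfolding extends_def by (metis nth_initial_segment)
qed

lemma extends_prefix: "extends G \<tau> \<Longrightarrow> prefix \<sigma> \<tau> \<Longrightarrow> extends G \<sigma>"
  by (auto simp: extends_iff prefix_def nth_append)

lemma initial_segment_eq_take:
  "extends G \<sigma> \<Longrightarrow> l \<le> length \<sigma> \<Longrightarrow> initial_segment G l = take l \<sigma>"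
  by (rule nth_equalityI) (auto simp: extends_iff)

text \<open>All numbers serve as indices; those that code no program merely add further sets to meet
  or avoid.\<close>

definition accepted :: "nat \<Rightarrow> bool list set" where
  "accepted j = {\<sigma>. \<exists>t y. halts t {} j (list_encode [string_code \<sigma>]) y}"

lemma accepted_program_code: "accepted (program_code p) = {\<sigma>. \<exists>y. computes {} p [string_code \<sigma>] y}"
  unfolding accepted_def using computes_of_halts halts_of_computes by fast

text \<open>The invariant of the construction: the marks inside \<open>\<sigma>\<close> do not prevent a mark at a level
  \<open>e \<ge> s\<close> that is appended later from being honoured.\<close>

definition unblocked :: "nat \<Rightarrow> bool list \<Rightarrow> bool" where
  "unblocked s \<sigma> \<longleftrightarrow> (\<sigma> \<noteq> [] \<longrightarrow> \<not> last \<sigma>) \<and>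
    (\<forall>G n e d. extends G \<sigma> \<and> n < length \<sigma> \<and> s \<le> e \<and> marks G n e d \<longrightarrow>
      (\<exists>a<s. meets_by G a (length \<sigma>) \<and> \<not> meets_by G a n))"

text \<open>After \<tau>, which either is \<sigma> or meets the s-th set for the first time, come
  zeros, the run of ones claiming d at level s, and a zero. Earlier marks do not block this claim:
  either meeting the s-th set is new since then, or, for \<tau> = \<sigma>, the invariant supplies
  an index below s.\<close>

lemma next_stage:
  assumes \<sigma>: "unblocked s \<sigma>"
  obtains \<sigma>' where "prefix \<sigma> \<sigma>'" "unblocked (Suc s) \<sigma>'"
    "\<And>G. extends G \<sigma>' \<Longrightarrow> d \<in> trace G s"
    "(\<exists>l\<le>length \<sigma>'. take l \<sigma>' \<in> accepted s) \<or> \<not> (\<exists>\<tau>\<in>accepted s. prefix \<sigma> \<tau>)"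
proof -
  define act where "act \<longleftrightarrow> (\<forall>l\<le>length \<sigma>. take l \<sigma> \<notin> accepted s) \<and> (\<exists>\<tau>\<in>accepted s. prefix \<sigma> \<tau>)"
  \<comment> \<open>The k zeros leave time for the acceptance of \<tau> to be seen before the new
    mark; at least one is needed to delimit its run on the left.\<close>
  obtain \<tau> k where \<tau>: "prefix \<sigma> \<tau>" "k > 0" "\<not> act \<Longrightarrow> \<tau> = \<sigma>" "act \<Longrightarrow> \<tau> \<in> accepted s"
    and meets: "\<And>G. act \<Longrightarrow> extends G \<tau> \<Longrightarrow> meets_by G s (length \<tau> + k)"
    and not_meets: "\<And>G n. act \<Longrightarrow> extends G \<tau> \<Longrightarrow> n \<le> length \<tau> \<Longrightarrow> \<not> meets_by G s n"
  proof (cases act)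
    case True
    then obtain \<tau>0 where "\<tau>0 \<in> accepted s \<and> prefix \<sigma> \<tau>0" by (auto simp: act_def)
    \<comment> \<open>By minimality no shorter initial segment of \<tau> is accepted, so the set
      counts as met only after every mark inside \<tau>. As \<open>meets_by\<close> at n uses
      segments shorter than n, this includes a mark at position
      \<open>length \<tau>\<close>.\<close>
    from ex_has_least_nat[of "\<lambda>\<tau>. \<tau> \<in> accepted s \<and> prefix \<sigma> \<tau>", OF this, of length]
    obtain \<tau> where \<tau>: "\<tau> \<in> accepted s" "prefix \<sigma> \<tau>"
      and least: "\<And>\<tau>'. \<tau>' \<in> accepted s \<Longrightarrow> prefix \<sigma> \<tau>' \<Longrightarrow> length \<tau> \<le> length \<tau>'"
      by blast
    obtain t y where ty: "halts t {} s (list_encode [string_code \<tau>]) y"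
      using \<tau>(1) by (auto simp: accepted_def)
    show ?thesis
    proof (rule that)
      fix G assume G: "extends G \<tau>"
      then have "initial_segment G (length \<tau>) = \<tau>" by (simp add: extends_def)
      moreover have "halts (length \<tau> + Suc (t + y)) {} s (list_encode [string_code \<tau>]) y"
        by (rule halts_mono[OF ty]) simp
      ultimately show "meets_by G s (length \<tau> + Suc (t + y))"
        unfolding meets_by_def by (intro exI[of _ "length \<tau>"] exI[of _ y] conjI) auto
      fix n assume n: "n \<le> length \<tau>"
      show "\<not> meets_by G s n"
      proof
        assume "meets_by G s n"
        then obtain l where l: "l < n" "initial_segment G l \<in> accepted s"
          by (auto simp: meets_by_def accepted_def)
        with n G have take: "take l \<tau> \<in> accepted s" by (simp add: initial_segment_eq_take)
        show False
        proof (cases "l \<le> length \<sigma>")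
          case True
          with \<tau>(2) have "take l \<tau> = take l \<sigma>" by (auto simp: prefix_def)
          with take True \<open>act\<close> show False by (auto simp: act_def)
        next
          case False
          with \<tau>(2) have "prefix \<sigma> (take l \<tau>)" by (auto simp: prefix_def)
          from least[OF take this] l(1) n show False by simp
        qed
      qed
    qed (use \<tau> True in auto)
  next
    case False
    show ?thesis by (rule that[of \<sigma> 1]) (use False in auto)
  qed
  define c where "c = Suc (prod_encode (s, d))"
  define \<sigma>' where "\<sigma>' = \<tau> @ replicate k False @ replicate c True @ [False]"
  define m where "m = length \<tau> + k + c"
  have c: "c > 0" by (simp add: c_def)
  have len: "length \<sigma>' = Suc m" by (simp add: \<sigma>'_def m_def)
  have pre: "prefix \<tau> \<sigma>'" by (simp add: \<sigma>'_def)
  have key: "marks G m s d"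
    "\<And>n e d'. n < m \<Longrightarrow> s \<le> e \<Longrightarrow> marks G n e d' \<Longrightarrow> \<exists>j<Suc s. meets_by G j m \<and> \<not> meets_by G j n"
    if G: "extends G \<sigma>'" for G
  proof -
    have ext\<tau>: "extends G \<tau>" using extends_prefix[OF G pre] .
    have bit: "i \<in> G \<longleftrightarrow> \<sigma>' ! i" if "i \<le> m" for i using G that by (simp add: extends_iff len)
    have pad: "i \<notin> G" if "length \<tau> \<le> i" "i < length \<tau> + k" for i
    proof -
      have "i - length \<tau> < k" using that by linarith
      then show ?thesis using bit[of i] that by (simp add: \<sigma>'_def m_def nth_append)
    qed
    have ones: "i \<in> G" if "length \<tau> + k \<le> i" "i < m" for i
    proof -
      have "\<not> i - length \<tau> < k" "i - (length \<tau> + k) < c" using that m_def by linarith+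
      then show ?thesis using bit[of i] that by (simp add: \<sigma>'_def m_def nth_append)
    qed
    have m: "m \<notin> G" using bit[of m] by (simp add: \<sigma>'_def m_def nth_append)
    show "marks G m s d"
      unfolding marks_def c_def[symmetric]
    proof (intro conjI allI impI m)
      show "m - Suc c \<notin> G" by (rule pad) (use \<tau>(2) in \<open>auto simp: m_def\<close>)
      fix i assume "i < c"
      then show "m - Suc i \<in> G" by (intro ones) (auto simp: m_def)
    qed (simp add: m_def)
    fix n e d' assume n: "n < m" "s \<le> e" "marks G n e d'"
    then have mk: "n \<notin> G" "n - 1 \<in> G" "n > 0" by (auto simp: marks_def)
    \<comment> \<open>A mark is a zero preceded by a one. From \<open>length \<tau>\<close> on there
      are zeros and then ones up to m, so no such pair lies there before m.\<close>
    have "n \<le> length \<tau>"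
    proof (rule ccontr)
      assume "\<not> n \<le> length \<tau>"
      then show False using pad[of "n - 1"] ones[of n] mk n(1) by (cases "n < length \<tau> + k") auto
    qed
    show "\<exists>j<Suc s. meets_by G j m \<and> \<not> meets_by G j n"
    proof (cases act)
      case True
      have "meets_by G s m"
        by (rule meets_by_mono[OF meets[OF True ext\<tau>]]) (simp add: m_def)
      then show ?thesis using not_meets[OF True ext\<tau> \<open>n \<le> length \<tau>\<close>] by blast
    next
      case False
      then have [simp]: "\<tau> = \<sigma>" by (rule \<tau>(3))
      \<comment> \<open>Since \<sigma> ends in a zero, no run reaches its end.\<close>
      have "n \<noteq> length \<sigma>"
      proof
        assume "n = length \<sigma>"
        moreover with mk(3) have "\<not> \<sigma> ! (length \<sigma> - 1)" using \<sigma> by (simp add: unblocked_def last_conv_nth)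
        ultimately show False using ext\<tau> mk by (simp add: extends_iff)
      qed
      with \<open>n \<le> length \<tau>\<close> have "n < length \<sigma>" by simp
      then obtain a where "a < s" "meets_by G a (length \<sigma>)" "\<not> meets_by G a n"
        using \<sigma> ext\<tau> n unfolding unblocked_def \<open>\<tau> = \<sigma>\<close> by meson
      moreover have "length \<sigma> \<le> m" by (simp add: m_def)
      ultimately show ?thesis using meets_by_mono less_SucI by blast
    qed
  qed
  show ?thesis
  proof (rule that)
    show "prefix \<sigma> \<sigma>'" using \<tau>(1) pre by (rule prefix_order.trans)
    show "unblocked (Suc s) \<sigma>'"
      unfolding unblocked_def
    proof (intro conjI allI impI, goal_cases)
      case 1
      show ?case by (simp add: \<sigma>'_def)
    next
      case (2 G n e d')
      have "n \<noteq> m" using marks_unique[OF key(1)] 2 by auto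
      with 2 have "n < m" by (simp add: len)
      then obtain j where "j < Suc s" "meets_by G j m" "\<not> meets_by G j n"
        using key(2)[of G n e d'] 2 by auto
      then show ?case using meets_by_mono[of G j m "length \<sigma>'"] by (auto simp: len)
    qed
    show "d \<in> trace G s" if "extends G \<sigma>'" for G
      using key[OF that] unfolding trace_def enumerates_at_def by blast
    show "(\<exists>l\<le>length \<sigma>'. take l \<sigma>' \<in> accepted s) \<or> \<not> (\<exists>\<tau>\<in>accepted s. prefix \<sigma> \<tau>)"
    proof (cases act)
      case True
      then have "take (length \<tau>) \<sigma>' \<in> accepted s" using \<tau>(4) by (simp add: \<sigma>'_def)
      then show ?thesis using len by (auto simp: m_def)
    next
      case False
      have take: "take l \<sigma>' = take l \<sigma>" if "l \<le> length \<sigma>" for l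
        using that \<tau>(3)[OF False] by (simp add: \<sigma>'_def)
      have "length \<sigma> \<le> length \<sigma>'" using \<tau>(3)[OF False] by (simp add: \<sigma>'_def)
      with False take show ?thesis unfolding act_def by (metis order_trans)
    qed
  qed
qed

text \<open>Neither d nor the sequence of stages has to be effective. Stage s settles the s-th set
  and makes the claim for \<open>d s\<close>; a set enumerated by p is treated at stage
  \<open>program_code p\<close>.\<close>

theorem one_generic_tracing:
  fixes d :: "nat \<Rightarrow> nat"
  obtains G where "one_generic G" "\<And>e. d e \<in> trace G e"
proof -
  define Q where "Q s \<sigma> \<sigma>' \<longleftrightarrow> prefix \<sigma> \<sigma>' \<and> (\<forall>G. extends G \<sigma>' \<longrightarrow> d s \<in> trace G s) \<and>
    ((\<exists>l\<le>length \<sigma>'. take l \<sigma>' \<in> accepted s) \<or> \<not> (\<exists>\<tau>\<in>accepted s. prefix \<sigma> \<tau>))" for s \<sigma> \<sigma>'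
  have "\<exists>f. \<forall>s. unblocked s (f s) \<and> Q s (f s) (f (Suc s))"
  proof (rule dependent_nat_choice)
    show "\<exists>\<sigma>. unblocked 0 \<sigma>" by (rule exI[of _ "[]"]) (simp add: unblocked_def)
    show "\<exists>\<sigma>'. unblocked (Suc s) \<sigma>' \<and> Q s \<sigma> \<sigma>'" if "unblocked s \<sigma>" for s \<sigma>
      by (rule next_stage[OF that, of "d s"]) (unfold Q_def, blast)
  qed
  then obtain f where Q: "\<And>s. Q s (f s) (f (Suc s))" by blast
  have f: "prefix (f s) (f (Suc s))" "extends G (f (Suc s)) \<Longrightarrow> d s \<in> trace G s"
    "(\<exists>l\<le>length (f (Suc s)). take l (f (Suc s)) \<in> accepted s) \<or> \<not> (\<exists>\<tau>\<in>accepted s. prefix (f s) \<tau>)"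
    for s G using Q[of s] unfolding Q_def by blast+
  have mono: "prefix (f s) (f t)" if "s \<le> t" for s t
    using that by (induction rule: dec_induct) (auto intro: f(1) prefix_order.trans)
  define G where "G = {i. \<exists>s. i < length (f s) \<and> f s ! i}"
  have ext: "extends G (f s)" for s
    unfolding extends_iff
  proof (intro allI impI iffI)
    fix i assume i: "i < length (f s)" "i \<in> G"
    then obtain t where t: "i < length (f t)" "f t ! i" by (auto simp: G_def)
    show "f s ! i" using mono[of s t] mono[of t s] t i(1)
      by (cases "s \<le> t") (auto simp: prefix_def nth_append)
  qed (auto simp: G_def)
  have "one_generic G"
    unfolding one_generic_def
  proof (intro allI impI)
    fix S assume "re_strings S"
    then obtain p where S: "S = accepted (program_code p)"
      by (auto simp: re_strings_def accepted_program_code)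
    from f(3)[of "program_code p"]
    show "(\<exists>n. initial_segment G n \<in> S) \<or> (\<exists>n. \<not> (\<exists>\<sigma>\<in>S. prefix (initial_segment G n) \<sigma>))"
    proof
      assume "\<exists>l\<le>length (f (Suc (program_code p))).
        take l (f (Suc (program_code p))) \<in> accepted (program_code p)"
      then show ?thesis using initial_segment_eq_take[OF ext] by (metis S)
    next
      assume "\<not> (\<exists>\<tau>\<in>accepted (program_code p). prefix (f (program_code p)) \<tau>)"
      then show ?thesis using ext[of "program_code p"] unfolding extends_def S by metis
    qed
  qed
  moreover have "d e \<in> trace G e" for e by (rule f(2)[OF ext])
  ultimately show ?thesis by (rule that)
qed

section \<open>Probability: Chebyshev's inequality and the strong law for fair coins\<close>

section \<open>Finitely determined events of coin tossing\<close>

definition depends_on :: "nat set \<Rightarrow> (nat set \<Rightarrow> bool) \<Rightarrow> bool" where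
  "depends_on I Q \<longleftrightarrow> (\<forall>Z. Q (Z \<inter> I) = Q Z)"

lemma prob_space_coin: "prob_space coin_measure"
  unfolding coin_measure_def by (intro prob_space_PiM prob_space_measure_pmf)

lemma space_coin [simp]: "space coin_measure = UNIV"
  by (simp add: coin_measure_def space_PiM)

lemma coin_cylinder:
  assumes I: "finite I" and A: "A \<subseteq> I"
  shows "{Z. Collect Z \<inter> I = A} \<in> sets coin_measure"
    and "measure coin_measure {Z. Collect Z \<inter> I = A} = 1 / 2 ^ card I"
proof -
  let ?M = "\<lambda>_ :: nat. measure_pmf (bernoulli_pmf (1/2))"
  interpret product_prob_space ?M "UNIV :: nat set"
    by unfold_locales
  have eq: "{Z. Collect Z \<inter> I = A} = prod_emb UNIV ?M I (\<Pi>\<^sub>E i\<in>I. {i \<in> A})"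
  proof -
    have "Collect Z \<inter> I = A \<longleftrightarrow> (\<forall>i\<in>I. Z i = (i \<in> A))" for Z using A by auto
    moreover have "Z \<in> prod_emb UNIV ?M I (\<Pi>\<^sub>E i\<in>I. {i \<in> A}) \<longleftrightarrow> (\<forall>i\<in>I. Z i = (i \<in> A))" for Z
      by (simp add: prod_emb_iff restrict_PiE_iff Pi_iff)
    ultimately show ?thesis by (intro set_eqI) (simp only: mem_Collect_eq)
  qed
  show "{Z. Collect Z \<inter> I = A} \<in> sets coin_measure"
    unfolding eq coin_measure_def by (intro sets_PiM_I) (auto simp: I)
  have "measure coin_measure {Z. Collect Z \<inter> I = A} = (\<Prod>i\<in>I. measure (?M i) {i \<in> A})"
    unfolding eq coin_measure_def by (rule measure_PiM_emb) (auto simp: I)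
  also have "\<dots> = (\<Prod>i\<in>I. 1 / 2)"
    by (intro prod.cong refl) (simp add: measure_pmf_single)
  finally show "measure coin_measure {Z. Collect Z \<inter> I = A} = 1 / 2 ^ card I"
    by (simp add: power_divide)
qed

lemma
  assumes I: "finite I" and Q: "depends_on I Q"
  shows sets_depends_on: "{Z. Q (Collect Z)} \<in> sets coin_measure"
    and measure_depends_on:
      "measure coin_measure {Z. Q (Collect Z)} = card {A. A \<subseteq> I \<and> Q A} / 2 ^ card I"
proof -
  interpret prob_space coin_measure by (rule prob_space_coin)
  let ?C = "\<lambda>A. {Z. Collect Z \<inter> I = A}"
  let ?F = "{A. A \<subseteq> I \<and> Q A}"
  have fin: "finite ?F" by (rule finite_subset[of _ "Pow I"]) (auto simp: I)
  have eq: "{Z. Q (Collect Z)} = (\<Union>A\<in>?F. ?C A)"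
  proof (intro equalityI subsetI)
    fix Z assume "Z \<in> {Z. Q (Collect Z)}"
    then have "Q (Collect Z \<inter> I)" using Q by (simp add: depends_on_def)
    then show "Z \<in> (\<Union>A\<in>?F. ?C A)" by (intro UN_I[of "Collect Z \<inter> I"]) simp_all
  next
    fix Z assume "Z \<in> (\<Union>A\<in>?F. ?C A)"
    then obtain A where "A \<in> ?F" "Z \<in> ?C A" by (rule UN_E)
    then have "Q (Collect Z \<inter> I)" by simp
    then show "Z \<in> {Z. Q (Collect Z)}" using Q by (simp add: depends_on_def)
  qed
  show "{Z. Q (Collect Z)} \<in> sets coin_measure"
    unfolding eq using fin coin_cylinder(1)[OF I] by (intro sets.finite_UN) auto
  have "measure coin_measure (\<Union>A\<in>?F. ?C A) = (\<Sum>A\<in>?F. measure coin_measure (?C A))"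
  proof (rule finite_measure_finite_Union)
    show "?C ` ?F \<subseteq> events" 
    proof
      fix E assume "E \<in> ?C ` ?F"
      then obtain A where "A \<subseteq> I" "E = ?C A" by blast
      then show "E \<in> events" using coin_cylinder(1)[OF I] by simp
    qed
    show "disjoint_family_on ?C ?F"
      unfolding disjoint_family_on_def
    proof (intro ballI impI)
      fix A B :: "nat set" assume "A \<noteq> B"
      then show "?C A \<inter> ?C B = {}" by (simp add: disjoint_iff)
    qed
  qed (rule fin)
  also have "\<dots> = (\<Sum>A\<in>?F. 1 / 2 ^ card I)"
    by (intro sum.cong refl coin_cylinder(2)[OF I]) auto
  finally show "measure coin_measure {Z. Q (Collect Z)} = card ?F / 2 ^ card I"
    unfolding eq by simp
qed

section \<open>Agreement on a finite set\<close>

text \<open>The threshold is the proportion \<open>1/2 + 1/(k+1)\<close>.\<close>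

definition disagree_much :: "nat \<Rightarrow> nat set \<Rightarrow> nat set \<Rightarrow> nat set \<Rightarrow> bool" where
  "disagree_much k I A B \<longleftrightarrow> (k + 3) * card I < 2 * (k + 1) * card (I \<inter> sym_diff A B)"

lemma sum_Pow_insert:
  assumes "finite I" "x \<notin> I"
  shows "(\<Sum>A\<in>Pow (insert x I). f A) = (\<Sum>A\<in>Pow I. f A + f (insert x A))"
proof -
  have "(\<Sum>A\<in>Pow (insert x I). f A) = (\<Sum>A\<in>Pow I. f A) + (\<Sum>A\<in>insert x ` Pow I. f A)"
    unfolding Pow_insert using assms by (intro sum.union_disjoint) auto
  also have "(\<Sum>A\<in>insert x ` Pow I. f A) = (\<Sum>A\<in>Pow I. f (insert x A))"
    by (subst sum.reindex) (use assms in \<open>auto simp: inj_on_def\<close>)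
  finally show ?thesis by (simp add: sum.distrib)
qed

text \<open>The second moment of a sum of independent signs: \<open>card I - 2 * card A\<close>
  collects 1 for each point outside A and -1 for each point in A. The induction step is (a + 1)^2 +
  (a - 1)^2 = 2 * a^2 + 2.\<close>

lemma sum_squares_Pow:
  assumes "finite I"
  shows "(\<Sum>A\<in>Pow I. (real (card I) - 2 * real (card A))\<^sup>2) = 2 ^ card I * real (card I)"
  using assms
proof (induction I rule: finite_induct)
  case (insert x I)
  have "(\<Sum>A\<in>Pow (insert x I). (real (card (insert x I)) - 2 * real (card A))\<^sup>2) =
      (\<Sum>A\<in>Pow I. 2 * (real (card I) - 2 * real (card A))\<^sup>2 + 2)"
    unfolding sum_Pow_insert[OF insert.hyps]
  proof (intro sum.cong refl)
    fix A assume "A \<in> Pow I"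
    then have "finite A" "x \<notin> A" using insert.hyps finite_subset by auto
    then show "(real (card (insert x I)) - 2 * real (card A))\<^sup>2 +
        (real (card (insert x I)) - 2 * real (card (insert x A)))\<^sup>2 =
        2 * (real (card I) - 2 * real (card A))\<^sup>2 + 2"
      using insert.hyps by (simp add: power2_eq_square algebra_simps)
  qed
  also have "\<dots> = 2 * (2 ^ card I * real (card I)) + 2 * 2 ^ card I"
    using insert by (simp add: sum.distrib card_Pow flip: sum_distrib_left)
  also have "\<dots> = 2 ^ card (insert x I) * real (card (insert x I))"
    using insert.hyps by (simp add: algebra_simps)
  finally show ?case .
qed simp

text \<open>Chebyshev's inequality by counting. The factor \<open>card I\<close> left in the
  denominator is what makes the bounds summable over the blocks.\<close>

lemma card_disagree_much:
  assumes I: "finite I" "I \<noteq> {}"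
  shows "real (card {A. A \<subseteq> I \<and> disagree_much k I A B}) \<le> 2 ^ card I * (real (k + 1))\<^sup>2 / (4 * real (card I))"
proof -
  define N where "N = real (card I)"
  have N: "N > 0" using I by (simp add: N_def card_gt_0_iff)
  define S where "S = {A. A \<subseteq> I \<and> disagree_much k I A B}"
  define g where "g A = (N - 2 * real (card (I \<inter> sym_diff A B)))\<^sup>2" for A
  have fin: "finite S" by (rule finite_subset[of _ "Pow I"]) (auto simp: I S_def)
  have "(\<Sum>A\<in>Pow I. g A) = (\<Sum>A\<in>Pow I. (N - 2 * real (card A))\<^sup>2)"
  \<comment> \<open>Taking the symmetric difference with B inside I is an involution of
    \<open>Pow I\<close>, which reduces the sum to the case of empty B.\<close>
  proof (rule sum.reindex_bij_witness[of _ "\<lambda>A. I \<inter> sym_diff A B" "\<lambda>A. I \<inter> sym_diff A B"])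
    fix A assume "A \<in> Pow I"
    then show "(N - 2 * real (card (I \<inter> sym_diff A B)))\<^sup>2 = g A" by (simp add: g_def)
  qed auto
  also have "\<dots> = 2 ^ card I * N" unfolding N_def by (rule sum_squares_Pow[OF I(1)])
  finally have sum: "(\<Sum>A\<in>Pow I. g A) = 2 ^ card I * N" .
  \<comment> \<open>Exceeding the proportion 1/2 + 1/(k+1) makes the sum of signs deviate from its
    mean 0 by at least 2N/(k+1).\<close>
  have big: "4 * N\<^sup>2 / (real (k + 1))\<^sup>2 \<le> g A" if "A \<in> S" for A
  proof -
    let ?h = "real (card (I \<inter> sym_diff A B))"
    have "real ((k + 3) * card I) < real (2 * (k + 1) * card (I \<inter> sym_diff A B))"
      using that unfolding S_def disagree_much_def of_nat_less_iff by simp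
    then have "real (k + 3) * N < 2 * real (k + 1) * ?h" by (simp add: N_def algebra_simps)
    then have "2 * N \<le> (2 * ?h - N) * real (k + 1)" by (simp add: algebra_simps)
    then have "2 * N / real (k + 1) \<le> 2 * ?h - N" by (simp add: field_simps)
    then have "(2 * N / real (k + 1))\<^sup>2 \<le> (2 * ?h - N)\<^sup>2" using N by (intro power_mono) auto
    also have "\<dots> = g A" by (simp add: g_def power2_commute)
    finally show ?thesis by (simp add: power_divide power_mult_distrib)
  qed
  have "real (card S) * (4 * N\<^sup>2 / (real (k + 1))\<^sup>2) = (\<Sum>A\<in>S. 4 * N\<^sup>2 / (real (k + 1))\<^sup>2)" by simp
  also have "\<dots> \<le> (\<Sum>A\<in>S. g A)" by (intro sum_mono big)
  also have "\<dots> \<le> (\<Sum>A\<in>Pow I. g A)"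
    by (intro sum_mono2) (auto simp: I S_def g_def)
  finally have le: "real (card S) * (4 * N\<^sup>2 / (real (k + 1))\<^sup>2) \<le> 2 ^ card I * N" unfolding sum .
  define r where "r = (real (k + 1))\<^sup>2"
  have "r > 0" by (simp add: r_def)
  with le have "(real (card S) * (4 * N)) * N \<le> (2 ^ card I * r) * N"
    unfolding r_def[symmetric] by (simp add: divide_le_eq power2_eq_square mult_ac)
  then have "real (card S) * (4 * N) \<le> 2 ^ card I * r"
    using N by (rule mult_right_le_imp_le)
  then have "real (card S) \<le> 2 ^ card I * (real (k + 1))\<^sup>2 / (4 * N)"
    using N by (simp add: r_def le_divide_eq)
  then show ?thesis by (simp add: S_def N_def)
qed

section \<open>Agreement on all late cube blocks bounds the density\<close>

text \<open>Cubes balance two needs: blocks of length about 3m^2 make the Chebyshev bounds summable,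
  while next to the position m^3 a single block is negligible, so that frequencies on blocks control
  those on all initial segments.\<close>

definition block :: "nat \<Rightarrow> nat set" where
  "block m = {m ^ 3..<Suc m ^ 3}"

lemma finite_block [simp]: "finite (block m)"
  by (simp add: block_def)

lemma card_block: "card (block m) = 3 * m\<^sup>2 + 3 * m + 1"
proof -
  have "Suc m ^ 3 = (3 * m\<^sup>2 + 3 * m + 1) + m ^ 3"
    by (simp add: power3_eq_cube power2_eq_square algebra_simps)
  then show ?thesis by (simp only: block_def card_atLeastLessThan add_diff_cancel_right')
qed

lemma block_nonempty [simp]: "block m \<noteq> {}"
  using card_block[of m] by (metis Suc_eq_plus1 card.empty nat.distinct(1))

lemma density_dist_le_blocks:
  assumes good: "\<And>m. m \<ge> m0 \<Longrightarrow> \<not> disagree_much k (block m) A B"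
  shows "density_dist A B \<le> ereal (1 / 2 + 1 / real (k + 1))"
proof -
  define c where "c = 1 / 2 + 1 / real (k + 1)"
  have c: "c = (k + 3) / (2 * (k + 1))" by (simp add: c_def field_simps)
  have c0: "c > 0" by (simp add: c_def add_pos_pos)
  define D where "D = sym_diff A B"
  define f where "f n = real (card (D \<inter> {..<n}))" for n
  have f_mono: "f n \<le> f n'" if "n \<le> n'" for n n'
    unfolding f_def of_nat_le_iff by (intro card_mono) (use that in auto)
  have cubes: "f (m ^ 3) \<le> real (m0 ^ 3) + c * real (m ^ 3)" for m
  proof (induction m)
    case (Suc m)
    show ?case
    proof (cases "m < m0")
      case True
      have "card (D \<inter> {..<Suc m ^ 3}) \<le> card {..<Suc m ^ 3}" by (intro card_mono) auto
      then have "f (Suc m ^ 3) \<le> real (Suc m ^ 3)" unfolding f_def of_nat_le_iff by simp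
      also have "real (Suc m ^ 3) \<le> real (m0 ^ 3)"
        unfolding of_nat_le_iff by (rule power_mono) (use True in auto)
      also have "\<dots> \<le> real (m0 ^ 3) + c * real (Suc m ^ 3)" using c0 by simp
      finally show ?thesis .
    next
      case False
      have "m ^ 3 \<le> Suc m ^ 3" by (rule power_mono) auto
      then have "D \<inter> {..<Suc m ^ 3} = (D \<inter> {..<m ^ 3}) \<union> (block m \<inter> D)"
        by (auto simp: block_def simp del: power_Suc intro: less_le_trans)
      then have "f (Suc m ^ 3) \<le> f (m ^ 3) + card (block m \<inter> D)"
        unfolding f_def using card_Un_le[of "D \<inter> {..<m ^ 3}" "block m \<inter> D"]
        by (metis of_nat_add of_nat_le_iff)
      moreover have "real (2 * (k + 1) * card (block m \<inter> D)) \<le> real ((k + 3) * card (block m))"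
        using good[of m] False unfolding of_nat_le_iff by (simp add: disagree_much_def D_def)
      then have "card (block m \<inter> D) \<le> c * card (block m)"
        unfolding c by (simp add: field_simps)
      moreover have "real (card (block m)) = real (Suc m ^ 3) - real (m ^ 3)"
        using \<open>m ^ 3 \<le> Suc m ^ 3\<close> by (simp add: block_def of_nat_diff del: of_nat_power)
      ultimately show ?thesis using Suc by (simp add: algebra_simps del: of_nat_power of_nat_Suc)
    qed
  qed (simp add: f_def)
  \<comment> \<open>Bounds the frequency at n through the end of the block that contains n: this end
    is at most (n^(1/3) + 1)^3, and the blocks before m0 contribute at most m0^3.\<close>
  define g where "g n = (real (m0 ^ 3) + c * (real n powr (1/3) + 1) ^ 3) / real n" for n :: nat
  have fg: "f n / real n \<le> g n" if n: "n > 0" for n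
  proof -
    define m where "m = (LEAST m. n < Suc m ^ 3)"
    have "n < Suc n ^ 3" using self_le_power[of "Suc n" 3] by simp
    then have m: "n < Suc m ^ 3" unfolding m_def by (rule LeastI)
    have "m ^ 3 \<le> n"
    proof (cases m)
      case (Suc m')
      then show ?thesis using not_less_Least[of m' "\<lambda>m. n < Suc m ^ 3"] by (simp add: m_def)
    qed simp
    then have "real m ^ 3 \<le> real n" by (metis of_nat_le_iff of_nat_power)
    then have "(real m ^ 3) powr (1/3) \<le> real n powr (1/3)" by (intro powr_mono2) auto
    moreover have "(real m ^ 3) powr (1/3) = real m"
    proof (cases "m = 0")
      case False
      then have "real m ^ 3 = real m powr 3" using powr_realpow[of "real m" 3] by simp
      then show ?thesis by (simp only: powr_powr) simp
    qed simp
    ultimately have "real m \<le> real n powr (1/3)" by simp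
    then have "(real m + 1) ^ 3 \<le> (real n powr (1/3) + 1) ^ 3" by (intro power_mono) auto
    then have "real (Suc m ^ 3) \<le> (real n powr (1/3) + 1) ^ 3" by (simp add: add.commute)
    then have "c * real (Suc m ^ 3) \<le> c * (real n powr (1/3) + 1) ^ 3" using c0 by simp
    moreover have "f n \<le> f (Suc m ^ 3)" using m by (intro f_mono) simp
    ultimately have "f n \<le> real (m0 ^ 3) + c * (real n powr (1/3) + 1) ^ 3"
      using cubes[of "Suc m"] by linarith
    then show ?thesis unfolding g_def by (rule divide_right_mono) simp
  qed
  have "g \<longlonglongrightarrow> c"
    unfolding g_def using c0 by real_asymp
  then have lim: "(\<lambda>n. ereal (g n)) \<longlonglongrightarrow> ereal c" by simp
  have "density_dist A B = limsup (\<lambda>n. ereal (f n / real n))"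
    by (simp add: density_dist_def f_def D_def)
  also have "\<dots> \<le> limsup (\<lambda>n. ereal (g n))"
    by (intro Limsup_mono eventually_mono[OF eventually_gt_at_top[of 0]]) (simp add: fg)
  also have "\<dots> = ereal c" using lim_imp_Limsup[OF _ lim] by simp
  finally show ?thesis by (simp add: c_def)
qed

section \<open>The strong law of large numbers for density distance\<close>

lemma inverse_square_tail_summable: "summable (\<lambda>m. C / (real m)\<^sup>2)"
  using summable_mult[OF inverse_power_summable[of 2], of C] by (simp add: divide_inverse)

lemma card_block_ge: "(real m)\<^sup>2 \<le> 4 * real (card (block m))"
  unfolding card_block by (simp add: power2_eq_square)

lemma measure_disagree_much_le:
  "measure coin_measure {Z. disagree_much k (block m) (Collect Z) B} \<le> (real (k + 1))\<^sup>2 / (4 * real (card (block m)))"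
proof -
  have "depends_on (block m) (\<lambda>Z. disagree_much k (block m) Z B)"
  proof -
    have "block m \<inter> sym_diff (Z \<inter> block m) B = block m \<inter> sym_diff Z B" for Z by auto
    then show ?thesis by (simp add: depends_on_def disagree_much_def)
  qed
  from measure_depends_on[OF finite_block this] show ?thesis
    using divide_right_mono[OF card_disagree_much[of "block m" k B], of "2 ^ card (block m)"] by simp
qed

lemma AE_density_dist_le_half: "AE Z in coin_measure. density_dist (Collect Z) B \<le> ereal (1 / 2)"
proof -
  interpret prob_space coin_measure by (rule prob_space_coin)
  have "AE Z in coin_measure. density_dist (Collect Z) B \<le> ereal (1 / 2 + 1 / real (k + 1))" for k
  proof -
    let ?E = "\<lambda>m. {Z. disagree_much k (block m) (Collect Z) B}"
    have meas: "?E m \<in> events" for m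
    proof -
      have "block m \<inter> sym_diff (Z \<inter> block m) B = block m \<inter> sym_diff Z B" for Z by auto
      then show ?thesis
        by (intro sets_depends_on[of "block m"]) (simp_all add: depends_on_def disagree_much_def)
    qed
    have "AE Z in coin_measure. eventually (\<lambda>m. Z \<in> space coin_measure - ?E m) sequentially"
    proof (rule borel_cantelli_AE1)
      define g where "g m = (real (k + 1))\<^sup>2 / (real m)\<^sup>2" for m
      \<comment> \<open>Block 0 is left out, as its bound would be a quotient by 0, which is
        0.\<close>
      have bound: "prob (?E (Suc m)) \<le> g (Suc m)" for m
        unfolding g_def
        by (rule order_trans[OF measure_disagree_much_le divide_left_mono[OF card_block_ge]])
          (simp_all add: card_block add_pos_nonneg)
      have "summable g" unfolding g_def by (rule inverse_square_tail_summable)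
      then have "summable (\<lambda>m. g (Suc m))" by (rule summable_Suc_iff[THEN iffD2])
      then have "summable (\<lambda>m. prob (?E (Suc m)))"
      proof (rule summable_comparison_test'[where N = 0])
        fix m show "norm (prob (?E (Suc m))) \<le> g (Suc m)"
          using bound[of m] by (simp only: real_norm_def abs_of_nonneg[OF measure_nonneg])
      qed
      then show "summable (\<lambda>m. prob (?E m))" by (rule summable_Suc_iff[THEN iffD1])
    qed (simp_all add: meas emeasure_eq_measure)
    then show ?thesis
    proof eventually_elim
      case (elim Z)
      then obtain m0 where "\<And>m. m \<ge> m0 \<Longrightarrow> \<not> disagree_much k (block m) (Collect Z) B"
        by (auto simp: eventually_sequentially)
      then show ?case by (rule density_dist_le_blocks)
    qed
  qed
  then have "AE Z in coin_measure. \<forall>k. density_dist (Collect Z) B \<le> ereal (1 / 2 + 1 / real (k + 1))"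
    by (simp add: AE_all_countable)
  then show ?thesis
  proof eventually_elim
    case (elim Z)
    have "(\<lambda>k. ereal (1 / 2 + 1 / real (k + 1))) \<longlonglongrightarrow> ereal (1 / 2 + 0)"
      by (intro tendsto_ereal tendsto_add tendsto_const) real_asymp
    then show ?case
      by (intro LIMSEQ_le_const[of "\<lambda>k. ereal (1 / 2 + 1 / real (k + 1))"]) (use elim in auto)
  qed
qed

lemma density_dist_commute: "density_dist A B = density_dist B A"
  by (simp add: density_dist_def Un_commute)

text \<open>For n > 0 the disagreement frequencies with B and with its complement add up to 1, so a
  frequency bounded away below 1/2 for B would push that for the complement above 1/2. Upper bounds
  for a set and its complement thus give the exact distance 1/2 almost everywhere.\<close>

lemma density_dist_ge_half:
  assumes "density_dist A (- B) \<le> ereal (1 / 2)"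
  shows "ereal (1 / 2) \<le> density_dist A B"
proof (rule ccontr)
  define f where "f n = real (card (sym_diff A B \<inter> {..<n})) / real n" for n
  define g where "g n = real (card (sym_diff A (- B) \<inter> {..<n})) / real n" for n
  have fg: "g n = 1 - f n" if "n > 0" for n
  proof -
    have "sym_diff A (- B) \<inter> {..<n} = {..<n} - (sym_diff A B \<inter> {..<n})" by auto
    then have "card (sym_diff A (- B) \<inter> {..<n}) = n - card (sym_diff A B \<inter> {..<n})"
      by (simp add: card_Diff_subset)
    moreover have "card (sym_diff A B \<inter> {..<n}) \<le> card {..<n}" by (intro card_mono) auto
    ultimately show ?thesis using that by (simp add: f_def g_def of_nat_diff diff_divide_distrib)
  qed
  assume "\<not> ereal (1 / 2) \<le> density_dist A B"
  then have less: "limsup (\<lambda>n. ereal (f n)) < ereal (1 / 2)" by (simp add: density_dist_def f_def)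
  then obtain c where c: "limsup (\<lambda>n. ereal (f n)) < ereal c" "ereal c < ereal (1 / 2)"
    using ereal_dense2 by blast
  from Limsup_lessD[OF c(1)] have "\<forall>\<^sub>F n in sequentially. ereal (1 - c) \<le> ereal (g n)"
    using eventually_gt_at_top[of 0] by eventually_elim (simp add: fg)
  then have "ereal (1 - c) \<le> limsup (\<lambda>n. ereal (g n))"
    by (intro le_Limsup) auto
  also have "\<dots> = density_dist A (- B)" by (simp add: density_dist_def g_def)
  also have "\<dots> \<le> ereal (1 / 2)" by (rule assms)
  finally show False using c(2) by simp
qed

lemma AE_density_dist_eq_half: "AE Z in coin_measure. density_dist A (Collect Z) = ereal (1 / 2)"
  using AE_density_dist_le_half[of A] AE_density_dist_le_half[of "- A"]
proof eventually_elim
  case (elim Z)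
  then show ?case
    using density_dist_ge_half[of "Collect Z" A] by (simp add: density_dist_commute order_antisym)
qed

section \<open>Clopen sets as finite objects, and clopen covers of the bad oracles\<close>

section \<open>Finite unions of cylinders as numbers\<close>

lemma depends_on_mono: "depends_on I Q \<Longrightarrow> I \<subseteq> J \<Longrightarrow> depends_on J Q"
  unfolding depends_on_def by (metis inf.absorb_iff2 inf_assoc)

text \<open>A clopen set is coded by a length K and a list of strings of length K, each string given
  as the finite set coded by a number v.\<close>

definition covers :: "nat \<Rightarrow> nat set \<Rightarrow> bool" where
  "covers d Z \<longleftrightarrow> (\<exists>v\<in>set (list_decode (snd (prod_decode d))).
    \<forall>x<fst (prod_decode d). x \<in> Z \<longleftrightarrow> x \<in> set_decode v)"

text \<open>A sufficient condition for \<open>covers d\<close> to have probability at most \<open>4\<close> to the power \<open>-s\<close>.\<close>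

definition cheap :: "nat \<Rightarrow> nat \<Rightarrow> bool" where
  "cheap s d \<longleftrightarrow> 2 * s \<le> fst (prod_decode d) \<and>
    length (list_decode (snd (prod_decode d))) \<le> 2 ^ (fst (prod_decode d) - 2 * s)"

lemma depends_on_covers:
  assumes "d \<le> t" shows "depends_on {..<t} (covers d)"
proof -
  have "fst (prod_decode d) \<le> d"
    using le_prod_encode_1[of "fst (prod_decode d)" "snd (prod_decode d)"] by simp
  with assms have "x < fst (prod_decode d) \<Longrightarrow> x < t" for x by simp
  then show ?thesis unfolding depends_on_def covers_def by auto
qed

lemma sets_covers: "{Z. covers d (Collect Z)} \<in> sets coin_measure"
  by (rule sets_depends_on[OF finite_lessThan depends_on_covers[OF order_refl]])

lemma measure_covers:
  assumes "cheap s d" shows "measure coin_measure {Z. covers d (Collect Z)} \<le> 1 / 4 ^ s"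
proof -
  interpret prob_space coin_measure by (rule prob_space_coin)
  define K vs where "K = fst (prod_decode d)" and "vs = list_decode (snd (prod_decode d))"
  let ?C = "\<lambda>v. {Z. Collect Z \<inter> {..<K} = set_decode v \<inter> {..<K}}"
  have C: "?C v \<in> events" "prob (?C v) = 1 / 2 ^ K" for v
    using coin_cylinder[of "{..<K}" "set_decode v \<inter> {..<K}"] by auto
  have "covers d Z \<longleftrightarrow> (\<exists>v\<in>set vs. Z \<inter> {..<K} = set_decode v \<inter> {..<K})" for Z
    unfolding covers_def K_def[symmetric] vs_def[symmetric] by (intro bex_cong refl) blast
  then have "{Z. covers d (Collect Z)} = (\<Union>v\<in>set vs. ?C v)" by blast
  then have "prob {Z. covers d (Collect Z)} \<le> (\<Sum>v\<in>set vs. prob (?C v))"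
    using finite_measure_subadditive_finite[of "set vs" ?C] C(1) by auto
  also have "\<dots> = card (set vs) / 2 ^ K" by (simp add: C(2))
  also have "\<dots> \<le> 2 ^ (K - 2 * s) / 2 ^ K"
  proof (rule divide_right_mono)
    have "card (set vs) \<le> 2 ^ (K - 2 * s)"
      using assms card_length[of vs] by (simp add: cheap_def K_def vs_def)
    then show "real (card (set vs)) \<le> 2 ^ (K - 2 * s)" by (metis of_nat_le_iff of_nat_numeral of_nat_power)
  qed simp
  also have "\<dots> = 1 / 4 ^ s"
  proof -
    have "(2::real) ^ K = 2 ^ (K - 2 * s) * 2 ^ (2 * s)"
      using assms by (simp add: cheap_def K_def flip: power_add)
    then show ?thesis by (simp add: power_mult)
  qed
  finally show ?thesis .
qed

lemma covers_exists:
  assumes "depends_on {..<K0} Q"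
  obtains d where "\<And>Z. covers d Z \<longleftrightarrow> Q Z"
    "measure coin_measure {Z. Q (Collect Z)} \<le> 1 / 4 ^ s \<Longrightarrow> cheap s d"
proof -
  \<comment> \<open>The 2 * s additional bits only split cylinders, but \<open>cheap\<close>
    requires K to be at least 2 * s.\<close>
  define K where "K = K0 + 2 * s"
  have Q: "depends_on {..<K} Q" by (rule depends_on_mono[OF assms]) (simp add: K_def)
  define F where "F = {A. A \<subseteq> {..<K} \<and> Q A}"
  have "finite F" by (rule finite_subset[of _ "Pow {..<K}"]) (auto simp: F_def)
  \<comment> \<open>Without repetitions the length of the list is exactly 2^K times the measure, so
    that the measure bound implies \<open>cheap\<close>.\<close>
  then obtain As where As: "set As = F" "distinct As" using finite_distinct_list by blast
  define d where "d = prod_encode (K, list_encode (map set_encode As))"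
  have "covers d Z \<longleftrightarrow> Q Z" for Z
  proof -
    have "covers d Z \<longleftrightarrow> (\<exists>A\<in>F. \<forall>x<K. x \<in> Z \<longleftrightarrow> x \<in> set_decode (set_encode A))"
      by (simp add: covers_def d_def As(1)[symmetric])
    also have "\<dots> \<longleftrightarrow> (\<exists>A\<in>F. Z \<inter> {..<K} = A)"
    proof (rule bex_cong[OF refl])
      fix A assume A: "A \<in> F"
      then have "finite A" by (auto simp: F_def intro: finite_subset)
      with A show "(\<forall>x<K. x \<in> Z \<longleftrightarrow> x \<in> set_decode (set_encode A)) \<longleftrightarrow> Z \<inter> {..<K} = A"
        by (auto simp: F_def)
    qed
    also have "\<dots> \<longleftrightarrow> Q (Z \<inter> {..<K})" by (auto simp: F_def)
    also have "\<dots> \<longleftrightarrow> Q Z" using Q by (simp add: depends_on_def)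
    finally show ?thesis .
  qed
  moreover have "cheap s d" if "measure coin_measure {Z. Q (Collect Z)} \<le> 1 / 4 ^ s"
  proof -
    have "real (card F) / 2 ^ K \<le> 1 / 4 ^ s"
      using that measure_depends_on[OF _ Q] by (simp add: F_def)
    then have "real (card F) \<le> 2 ^ K / 4 ^ s" by (simp add: field_simps)
    also have "\<dots> = 2 ^ (K - 2 * s)" by (simp add: K_def power_add power_mult)
    finally have "card F \<le> 2 ^ (K - 2 * s)"
      by (metis of_nat_le_iff of_nat_numeral of_nat_power)
    moreover have "card F = length As" using As distinct_card by metis
    ultimately show ?thesis by (simp add: cheap_def d_def K_def)
  qed
  ultimately show ?thesis by (rule that)
qed

lemma decidable_in_covers [comp_intros]:
  assumes "computable_in X k f" "computable_in X k g"
  shows "decidable_in X k (\<lambda>e. covers (f e) (set_decode (g e)))"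
proof (rule decidable_in_subst2[OF _ assms])
  have "covers d Z \<longleftrightarrow> (\<exists>i<Suc (snd (prod_decode d)). drop_code (snd (prod_decode d)) i \<noteq> 0 \<and>
      (\<forall>x<fst (prod_decode d). x \<in> Z \<longleftrightarrow> x \<in> set_decode (nth_code (snd (prod_decode d)) i)))" for d Z
  proof -
    obtain vs where vs: "snd (prod_decode d) = list_encode vs" by (metis list_decode_inverse)
    have *: "(\<exists>v\<in>set vs. P v) \<longleftrightarrow>
        (\<exists>i<Suc (list_encode vs). drop_code (list_encode vs) i \<noteq> 0 \<and> P (nth_code (list_encode vs) i))" for P
    proof
      assume "\<exists>v\<in>set vs. P v"
      then obtain v where "v \<in> set vs" "P v" by blast
      then obtain i where i: "i < length vs" "P (vs ! i)" by (auto simp: in_set_conv_nth)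
      with length_le_list_encode[of vs] show "\<exists>i<Suc (list_encode vs). drop_code (list_encode vs) i \<noteq> 0 \<and>
          P (nth_code (list_encode vs) i)"
        by (intro exI[of _ i]) (simp add: nth_code_list_encode)
    next
      assume "\<exists>i<Suc (list_encode vs). drop_code (list_encode vs) i \<noteq> 0 \<and>
          P (nth_code (list_encode vs) i)"
      then obtain i where "i < length vs" "P (nth_code (list_encode vs) i)" by (auto simp: not_le)
      then show "\<exists>v\<in>set vs. P v" by (intro bexI[of _ "vs ! i"]) (simp_all add: nth_code_list_encode)
    qed
    show ?thesis unfolding covers_def vs list_encode_inverse * ..
  qed
  then show "decidable_in X 2 (\<lambda>e. covers (e 0) (set_decode (e 1)))"
    apply (simp only:)
    apply (intro comp_intros)
              apply simp_all
    done
qed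

lemma decidable_in_cheap [comp_intros]:
  assumes "computable_in X k f" "computable_in X k g"
  shows "decidable_in X k (\<lambda>e. cheap (f e) (g e))"
proof -
  have "cheap s d \<longleftrightarrow> 2 * s \<le> fst (prod_decode d) \<and>
    drop_code (snd (prod_decode d)) (2 ^ (fst (prod_decode d) - 2 * s)) = 0" for s d
    unfolding cheap_def by (metis drop_code_list_encode_eq_0 list_decode_inverse)
  then show ?thesis by (simp only:) (intro comp_intros assms)
qed

section \<open>Approximating a functional on almost every oracle\<close>

definition total_on :: "program \<Rightarrow> nat set \<Rightarrow> bool" where
  "total_on p Z \<longleftrightarrow> (\<forall>x. \<exists>b. computes Z p [x] (of_bool b))"

definition computed_set :: "program \<Rightarrow> nat set \<Rightarrow> nat set" where
  "computed_set p Z = {x. computes Z p [x] 1}"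

lemma computes_computed_set:
  assumes "total_on p Z"
  shows "computes Z p [x] (of_bool b) \<longleftrightarrow> b = (x \<in> computed_set p Z)"
proof -
  obtain c where c: "computes Z p [x] (of_bool c)" using assms by (auto simp: total_on_def)
  have iff: "computes Z p [x] y \<longleftrightarrow> y = of_bool c" for y
    using computes_deterministic[OF c] c by blast
  show ?thesis
    unfolding computed_set_def mem_Collect_eq iff by (cases b; cases c) simp_all
qed

text \<open>A computation that has not halted by time t counts as an error. This makes the condition
  clopen and decidable, and decreasing in t.\<close>

definition late_error :: "nat \<Rightarrow> nat \<Rightarrow> nat \<Rightarrow> nat set \<Rightarrow> nat \<Rightarrow> nat set \<Rightarrow> bool" where
  "late_error k a t u m Z \<longleftrightarrow> (k + 3) * card (block m) <
    2 * (k + 1) * card {x \<in> block m. \<not> halts t Z a (list_encode [x]) (of_bool (x \<in> u))}"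

lemma depends_on_late_error: "depends_on {..<t} (late_error k a t u m)"
proof -
  have "halts t (Z \<inter> {..<t}) a x y = halts t Z a x y" for Z x y
    by (rule halts_cong) auto
  then show ?thesis by (simp add: depends_on_def late_error_def)
qed

lemma late_error_antimono:
  assumes "late_error k a t' u m Z" "t \<le> t'" shows "late_error k a t u m Z"
proof -
  have "card {x \<in> block m. \<not> halts t' Z a (list_encode [x]) (of_bool (x \<in> u))} \<le>
      card {x \<in> block m. \<not> halts t Z a (list_encode [x]) (of_bool (x \<in> u))}"
    by (intro card_mono) (use assms(2) halts_mono in auto)
  then show ?thesis
    using assms(1) unfolding late_error_def by (meson less_le_trans mult_le_mono2)
qed

lemma late_error_sound:
  assumes "total_on p Z" "\<not> late_error k (program_code p) t u m Z"
  shows "\<not> disagree_much k (block m) u (computed_set p Z)"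
proof -
  have "block m \<inter> sym_diff u (computed_set p Z) \<subseteq>
      {x \<in> block m. \<not> halts t Z (program_code p) (list_encode [x]) (of_bool (x \<in> u))}"
  proof
    fix x assume x: "x \<in> block m \<inter> sym_diff u (computed_set p Z)"
    have "\<not> halts t Z (program_code p) (list_encode [x]) (of_bool (x \<in> u))"
      using computes_of_halts[of t Z p "[x]"] computes_computed_set[OF assms(1), of x "x \<in> u"] x by blast
    with x show "x \<in> {x \<in> block m. \<not> halts t Z (program_code p) (list_encode [x]) (of_bool (x \<in> u))}"
      by blast
  qed
  then have "card (block m \<inter> sym_diff u (computed_set p Z)) \<le>
      card {x \<in> block m. \<not> halts t Z (program_code p) (list_encode [x]) (of_bool (x \<in> u))}"
    by (intro card_mono) simp_all
  then show ?thesis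
    using assms(2) unfolding late_error_def disagree_much_def
    by (meson less_le_trans mult_le_mono2)
qed

text \<open>On a total oracle all computations on the finite block halt by a common time, after
  which the late errors are true disagreements only.\<close>

lemma late_error_complete:
  assumes "total_on p Z" "\<not> disagree_much k (block m) u (computed_set p Z)"
  shows "\<exists>t. \<not> late_error k (program_code p) t u m Z"
proof -
  have "\<exists>t. halts t Z (program_code p) (list_encode [x]) (of_bool (x \<in> computed_set p Z))" for x
    by (rule halts_of_computes) (simp add: computes_computed_set[OF assms(1)])
  then obtain T where T: "\<And>x. halts (T x) Z (program_code p) (list_encode [x]) (of_bool (x \<in> computed_set p Z))"
    by metis
  define t where "t = sum T (block m)"
  have "halts t Z (program_code p) (list_encode [x]) (of_bool (x \<in> computed_set p Z))"
    if "x \<in> block m" for x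
    by (rule halts_mono[OF T]) (use that in \<open>auto simp: t_def intro: member_le_sum\<close>)
  then have "{x \<in> block m. \<not> halts t Z (program_code p) (list_encode [x]) (of_bool (x \<in> u))} \<subseteq>
      block m \<inter> sym_diff u (computed_set p Z)"
    by (smt (verit, best) Diff_iff IntI UnCI mem_Collect_eq subsetI)
  then have "card {x \<in> block m. \<not> halts t Z (program_code p) (list_encode [x]) (of_bool (x \<in> u))} \<le>
      card (block m \<inter> sym_diff u (computed_set p Z))"
    by (intro card_mono) simp_all
  then show ?thesis
    using assms(2) unfolding late_error_def disagree_much_def
    by (meson less_le_trans mult_le_mono2)
qed

lemma sets_halts: "{Z. halts t (Collect Z) a x y} \<in> sets coin_measure"
proof (rule sets_depends_on[of "{..<t}"])
  have "halts t (Z \<inter> {..<t}) a x y = halts t Z a x y" for Z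
    by (rule halts_cong) simp
  then show "depends_on {..<t} (\<lambda>Z. halts t Z a x y)" by (simp add: depends_on_def)
qed simp

lemma computes_iff_halts:
  "computes Z p xs y \<longleftrightarrow> (\<exists>t. halts t Z (program_code p) (list_encode xs) y)"
  using computes_of_halts halts_of_computes by blast

lemma sets_total_on: "{Z. total_on p (Collect Z)} \<in> sets coin_measure"
proof -
  have "{Z. \<exists>t. halts t (Collect Z) a x y} \<in> sets coin_measure" for a x y
    using sets.sets_Collect_countable_Ex[of coin_measure "\<lambda>t Z. halts t (Collect Z) a x y"] sets_halts
    by simp
  then have "{Z. \<exists>b. \<exists>t. halts t (Collect Z) (program_code p) (list_encode [x]) (of_bool b)} \<in> sets coin_measure" for x
    using sets.sets_Collect_countable_Ex[of coin_measure
        "\<lambda>b Z. \<exists>t. halts t (Collect Z) (program_code p) (list_encode [x]) (of_bool b)"]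
    by (simp del: list_encode.simps)
  then show ?thesis
    unfolding total_on_def computes_iff_halts
    using sets.sets_Collect_countable_All[of coin_measure
        "\<lambda>x Z. \<exists>b. \<exists>t. halts t (Collect Z) (program_code p) (list_encode [x]) (of_bool b)"]
    by (simp del: list_encode.simps)
qed

lemma sets_late_error: "{Z. late_error k a t u m (Collect Z)} \<in> sets coin_measure"
  by (rule sets_depends_on[OF finite_lessThan depends_on_late_error])

text \<open>A random \<open>u\<close> disagrees too often with a given set only with small probability, so by averaging
  some fixed \<open>u\<close> is good for most oracles; then \<open>t\<close> is taken so large that most
  computations have converged.\<close>

lemma late_error_unlikely:
  assumes "m > 0"
  obtains t u where "finite u"
    "measure coin_measure {Z. total_on p (Collect Z) \<and> late_error k (program_code p) t u m (Collect Z)}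
      \<le> (real (k + 1))\<^sup>2 / (real m)\<^sup>2"
proof -
  interpret prob_space coin_measure by (rule prob_space_coin)
  define T where "T = {Z. total_on p (Collect Z)}"
  define L where "L u t = {Z\<in>T. late_error k (program_code p) t u m (Collect Z)}" for u t
  define D where "D u = {Z\<in>T. disagree_much k (block m) u (computed_set p (Collect Z))}" for u
  define N where "N = real (card (block m))"
  define c where "c = (real (k + 1))\<^sup>2 / (4 * N)"
  have L: "L u t \<in> events" for u t
    using sets.Int[OF sets_total_on sets_late_error, of p k "program_code p" t u m]
    by (simp add: L_def T_def Collect_conj_eq)
  have decr: "decseq (L u)" for u
    unfolding decseq_def L_def
  proof (intro allI impI subsetI CollectI conjI)
    fix t t' Z assume "t \<le> t'" and Z: "Z \<in> {Z \<in> T. late_error k (program_code p) t' u m (Collect Z)}"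
    then show "late_error k (program_code p) t u m (Collect Z)" by (auto intro: late_error_antimono)
    show "Z \<in> T" using Z by simp
  qed
  have D: "D u = (\<Inter>t. L u t)" for u
  proof (rule set_eqI)
    fix Z show "Z \<in> D u \<longleftrightarrow> Z \<in> (\<Inter>t. L u t)"
      using late_error_sound[of p "Collect Z" k _ u m] late_error_complete[of p "Collect Z" k m u]
      by (auto simp: D_def L_def T_def)
  qed
  have "range (L u) \<subseteq> events" for u using L by auto
  then have lim: "(\<lambda>t. prob (L u t)) \<longlonglongrightarrow> prob (D u)" for u
    unfolding D by (rule finite_Lim_measure_decseq[OF _ decr])
  have Dev: "D u \<in> events" for u unfolding D using L by auto
  have "\<exists>u\<in>Pow (block m). prob (D u) \<le> c"
  proof (rule ccontr)
    assume "\<not> (\<exists>u\<in>Pow (block m). prob (D u) \<le> c)"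
    then have "c < prob (D u)" if "u \<in> Pow (block m)" for u
      using that by (meson not_le)
    then have "(\<Sum>u\<in>Pow (block m). c) < (\<Sum>u\<in>Pow (block m). prob (D u))"
      by (intro sum_strict_mono) auto
    also have "\<dots> = (\<Sum>u\<in>Pow (block m). \<integral>Z. indicator (D u) Z \<partial>coin_measure)"
      using Dev by simp
    also have "\<dots> = (\<integral>Z. (\<Sum>u\<in>Pow (block m). indicator (D u) Z) \<partial>coin_measure)"
      using Dev by (intro Bochner_Integration.integral_sum[symmetric]) (auto simp: emeasure_eq_measure)
    also have "\<dots> \<le> (\<integral>Z. 2 ^ card (block m) * c \<partial>coin_measure)"
    proof (rule integral_mono)
      show "integrable coin_measure (\<lambda>Z. \<Sum>u\<in>Pow (block m). indicator (D u) Z :: real)"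
        using Dev by (intro Bochner_Integration.integrable_sum) (auto simp: emeasure_eq_measure)
      fix Z :: "nat \<Rightarrow> bool"
      let ?S = "{u. u \<subseteq> block m \<and> disagree_much k (block m) u (computed_set p (Collect Z))}"
      have "(\<Sum>u\<in>Pow (block m). indicator (D u) Z :: real) \<le>
          (\<Sum>u\<in>Pow (block m). indicator ?S u)"
        by (intro sum_mono) (auto simp: D_def split: split_indicator)
      also have "\<dots> = real (card ?S)"
      proof -
        have "Pow (block m) \<inter> {u. u \<in> ?S} = ?S" by blast
        then show ?thesis by (simp only: indicator_def sum_of_bool_eq finite_Pow_iff finite_block)
      qed
      also have "\<dots> \<le> 2 ^ card (block m) * c"
        using card_disagree_much[of "block m" k] by (simp add: c_def N_def)
      finally show "(\<Sum>u\<in>Pow (block m). indicator (D u) Z :: real) \<le> 2 ^ card (block m) * c" .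
    qed simp
    finally show False using prob_space by (simp add: card_Pow)
  qed
  then obtain u where u: "u \<subseteq> block m" "prob (D u) \<le> c" by auto
  \<comment> \<open>Strictness lets the bound survive the passage from the limit set
    \<open>D u\<close> to a finite time t.\<close>
  have "c < (real (k + 1))\<^sup>2 / (real m)\<^sup>2"
    unfolding c_def
  proof (rule divide_strict_left_mono)
    have "N = 3 * (real m)\<^sup>2 + 3 * real m + 1" by (simp add: N_def card_block)
    then show "(real m)\<^sup>2 < 4 * N" using zero_le_power2[of "real m"] by linarith
  qed (use assms in \<open>simp_all add: N_def card_block add_pos_nonneg\<close>)
  with u(2) have "prob (D u) < (real (k + 1))\<^sup>2 / (real m)\<^sup>2" by simp
  from order_tendstoD(2)[OF lim this]
  obtain t where "prob (L u t) < (real (k + 1))\<^sup>2 / (real m)\<^sup>2"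
    by (auto simp: eventually_sequentially)
  moreover have "finite u" using u(1) finite_block by (rule finite_subset)
  ultimately show ?thesis
    by (intro that[of u t]) (auto simp: L_def T_def)
qed

lemma program_code_inject: "program_code p = program_code q \<Longrightarrow> p = q"
proof (induction p arbitrary: q)
  case (Comp p ps)
  show ?case
  proof (cases q)
    case (Comp q' qs)
    with Comp.prems have *: "program_code p = program_code q'" "map program_code ps = map program_code qs"
      by (simp_all add: list_encode_eq)
    have "ps = qs" by (rule list.inj_map_strong[OF _ *(2)]) (rule Comp.IH(2))
    with Comp.IH(1)[OF *(1)] show ?thesis by (simp add: Comp)
  qed (use Comp.prems in auto)
next
  case (PrimRec p1 p2)
  then show ?case by (cases q) auto
next
  case (Mu p)
  then show ?case by (cases q) auto
qed (case_tac q; simp)+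

lemma countable_programs: "countable (UNIV :: program set)"
  by (rule countableI[of program_code]) (auto intro: injI program_code_inject)

lemma depends_on_bex_lessThan:
  fixes t :: "nat \<Rightarrow> nat"
  assumes "\<And>i. depends_on {..<t i} (Q i)"
  shows "depends_on {..<sum t {..<n}} (\<lambda>Z. \<exists>i<n. Q i Z)"
proof -
  have "depends_on {..<sum t {..<n}} (Q i)" if "i < n" for i
    using that by (intro depends_on_mono[OF assms]) (auto intro: less_le_trans member_le_sum)
  then show ?thesis unfolding depends_on_def by blast
qed

lemma depends_on_diff:
  assumes "depends_on {..<a} P" "depends_on {..<b} Q"
  shows "depends_on {..<a + b} (\<lambda>Z. P Z \<and> \<not> Q Z)"
proof -
  have "depends_on {..<a + b} P" "depends_on {..<a + b} Q"
    by (rule depends_on_mono[OF assms(1)], auto) (rule depends_on_mono[OF assms(2)], auto)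
  then show ?thesis unfolding depends_on_def by blast
qed

text \<open>Two kinds of smallness meet here. On total oracles the bad sets of the blocks from m0 on
  have a small sum of measures, which bounds d0. Partial oracles may err in every block, but the
  union of the bad sets, whatever its measure, has tails of measure tending to 0, and these can be
  cut into pieces as cheap as s demands.\<close>

lemma late_error_cover:
  fixes s :: "nat \<Rightarrow> nat"
  obtains m0 d0 dd t u where
    "measure coin_measure {Z. total_on p (Collect Z) \<and> covers d0 (Collect Z)} \<le> 1 / 2 ^ k"
    "\<And>j. cheap (s j) (dd j)"
    "\<And>m. m0 \<le> m \<Longrightarrow> finite (u m)"
    "\<And>m Z. m0 \<le> m \<Longrightarrow> late_error k (program_code p) (t m) (u m) m Z \<Longrightarrow>
      covers d0 Z \<or> (\<exists>j\<le>m. covers (dd j) Z)"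
proof -
  interpret prob_space coin_measure by (rule prob_space_coin)
  let ?a = "program_code p"
  define g where "g m = (real (k + 1))\<^sup>2 / (real m)\<^sup>2" for m :: nat
  have "\<forall>m. \<exists>t u. m > 0 \<longrightarrow> finite u \<and>
      prob {Z. total_on p (Collect Z) \<and> late_error k ?a t u m (Collect Z)} \<le> g m"
    unfolding g_def using late_error_unlikely[of _ p k] by metis
  then obtain t u where tu: "\<And>m. m > 0 \<Longrightarrow> finite (u m)"
    "\<And>m. m > 0 \<Longrightarrow> prob {Z. total_on p (Collect Z) \<and> late_error k ?a (t m) (u m) m (Collect Z)} \<le> g m"
    by metis
  have g: "summable g" unfolding g_def by (rule inverse_square_tail_summable)
  obtain N where N: "\<And>n. n \<ge> N \<Longrightarrow> norm (\<Sum>i. g (i + n)) < 1 / 2 ^ k"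
    using suminf_exist_split[OF _ g, of "1 / 2 ^ k"] by auto
  define m0 where "m0 = Suc N"
  define Q where "Q i = late_error k ?a (t (i + m0)) (u (i + m0)) (i + m0)" for i
  define E where "E i = {Z. Q i (Collect Z)}" for i
  define T where "T = {Z. total_on p (Collect Z)}"
  have E: "E i \<in> events" for i unfolding E_def Q_def by (rule sets_late_error)
  have T: "T \<in> events" unfolding T_def by (rule sets_total_on)
  have gsum: "summable (\<lambda>i. g (i + m0))" using g by (rule summable_ignore_initial_segment)
  have TE: "prob (T \<inter> E i) \<le> g (i + m0)" for i
    using tu(2)[of "i + m0"] by (simp add: T_def E_def Q_def m0_def Collect_conj_eq)
  have sumTE: "summable (\<lambda>i. prob (T \<inter> E i))"
    by (rule summable_comparison_test'[OF gsum, of 0])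
      (simp only: real_norm_def abs_of_nonneg[OF measure_nonneg] TE)
  have "prob (\<Union>i. T \<inter> E i) \<le> (\<Sum>i. prob (T \<inter> E i))"
    by (rule finite_measure_subadditive_countably) (use T E sumTE in auto)
  also have "\<dots> \<le> (\<Sum>i. g (i + m0))" by (rule suminf_le[OF TE sumTE gsum])
  also have "\<dots> \<le> 1 / 2 ^ k" using N[of m0] by (simp add: m0_def)
  finally have small: "prob (\<Union>i. T \<inter> E i) \<le> 1 / 2 ^ k" .
  define R where "R n = (\<Union>i. E i) - (\<Union>i<n. E i)" for n
  have R: "R n \<in> events" for n unfolding R_def using E by auto
  have "(\<lambda>n. prob (R n)) \<longlonglongrightarrow> prob (\<Inter>n. R n)"
  proof (rule finite_Lim_measure_decseq)
    show "decseq R" unfolding decseq_def R_def by fastforce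
  qed (use R in auto)
  moreover have "(\<Inter>n. R n) = {}" unfolding R_def by auto
  ultimately have R0: "(\<lambda>n. prob (R n)) \<longlonglongrightarrow> 0" by simp
  have "\<exists>n. prob (R n) \<le> 1 / 4 ^ s j" for j
    using order_tendstoD(2)[OF R0, of "1 / 4 ^ s j"]
    by (auto simp: eventually_sequentially intro: less_imp_le)
  then obtain M where M: "\<And>j. prob (R (M j)) \<le> 1 / 4 ^ s j" by metis
  \<comment> \<open>\<open>M (Suc j)\<close> makes piece j reach the beginning of piece j + 1.
    \<open>Suc j\<close> ensures that d0 and the pieces up to i exhaust the i-th bad set, so that a
    search on one block waits for finitely many pieces only.\<close>
  define L where "L j = max (Suc j) (M (Suc j))" for j
  have dep: "depends_on {..<(\<Sum>i<n. t (i + m0))} (\<lambda>Z. \<exists>i<n. Q i Z)" for n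
    by (rule depends_on_bex_lessThan) (simp add: Q_def depends_on_late_error)
  obtain d0 where d0: "\<And>Z. covers d0 Z \<longleftrightarrow> (\<exists>i<M 0. Q i Z)"
    by (rule covers_exists[OF dep, of _ 0]) blast
  have "\<exists>d. cheap (s j) d \<and> (\<forall>Z. covers d Z \<longleftrightarrow> (\<exists>i<L j. Q i Z) \<and> \<not> (\<exists>i<M j. Q i Z))" for j
  proof -
    obtain d where d: "\<And>Z. covers d Z \<longleftrightarrow> (\<exists>i<L j. Q i Z) \<and> \<not> (\<exists>i<M j. Q i Z)"
      "prob {Z. (\<exists>i<L j. Q i (Collect Z)) \<and> \<not> (\<exists>i<M j. Q i (Collect Z))} \<le> 1 / 4 ^ s j \<Longrightarrow> cheap (s j) d"
      by (rule covers_exists[OF depends_on_diff[OF dep dep], of "L j" "M j" "s j"]) blast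
    have "prob {Z. (\<exists>i<L j. Q i (Collect Z)) \<and> \<not> (\<exists>i<M j. Q i (Collect Z))} \<le> prob (R (M j))"
      by (rule finite_measure_mono) (use R in \<open>auto simp: R_def E_def\<close>)
    with d M[of j] show ?thesis by (intro exI[of _ d]) auto
  qed
  then obtain dd where dd: "\<And>j. cheap (s j) (dd j)"
    "\<And>j Z. covers (dd j) Z \<longleftrightarrow> (\<exists>i<L j. Q i Z) \<and> \<not> (\<exists>i<M j. Q i Z)"
    by metis
  show ?thesis
  proof (rule that)
    have "prob {Z. total_on p (Collect Z) \<and> covers d0 (Collect Z)} \<le> prob (\<Union>i. T \<inter> E i)"
      by (rule finite_measure_mono) (use T E in \<open>auto simp: T_def E_def d0\<close>)
    then show "prob {Z. total_on p (Collect Z) \<and> covers d0 (Collect Z)} \<le> 1 / 2 ^ k"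
      using small by simp
    show "cheap (s j) (dd j)" for j by (rule dd(1))
    show "finite (u m)" if "m0 \<le> m" for m using that by (intro tu(1)) (simp add: m0_def)
    show "covers d0 Z \<or> (\<exists>j\<le>m. covers (dd j) Z)"
      if m: "m0 \<le> m" "late_error k ?a (t m) (u m) m Z" for m Z
    proof (cases "\<exists>i<M 0. Q i Z")
      case False
      define i where "i = m - m0"
      define P where "P j \<longleftrightarrow> (\<exists>i<L j. Q i Z)" for j
      have "Q i Z" using m by (simp add: Q_def i_def)
      then have "P i" unfolding P_def by (intro exI[of _ i]) (simp add: L_def)
      \<comment> \<open>For the least j, if positive, the oracle avoids the first
        \<open>L (j - 1)\<close> bad sets and so the first \<open>M j\<close>; for j = 0 this is the
        case assumption. Hence it lies in the difference coded by \<open>dd j\<close>.\<close>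
      define j where "j = (LEAST j. P j)"
      have "P j" unfolding j_def using \<open>P i\<close> by (rule LeastI)
      moreover have "j \<le> i" unfolding j_def using \<open>P i\<close> by (rule Least_le)
      moreover have "\<not> (\<exists>i<M j. Q i Z)"
      proof (cases j)
        case (Suc j')
        then have "\<not> P j'" using not_less_Least[of j' P] by (simp add: j_def)
        then show ?thesis by (auto simp: P_def L_def Suc)
      qed (use False in simp)
      ultimately have "covers (dd j) Z" by (simp add: dd(2) P_def)
      then show ?thesis using \<open>j \<le> i\<close> by (auto simp: i_def)
    qed (simp add: d0)
  qed
qed

section \<open>Computing approximations from the generic set, and the resulting distance\<close>

section \<open>Coarse approximations below the generic\<close>

text \<open>The levels \<open>prod_encode (q, j)\<close> are reserved for the requirement \<open>q\<close>.\<close>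

definition trashed :: "nat set \<Rightarrow> nat \<Rightarrow> nat set \<Rightarrow> bool" where
  "trashed G q Z \<longleftrightarrow> (\<exists>j. \<exists>d\<in>trace G (prod_encode (q, j)). cheap (prod_encode (q, j)) d \<and> covers d Z)"

text \<open>Level s contributes at most (s + 2) * 4^-s, which is at most 2 * 2^-s. Here s, the code
  of the pair (q, j), is at least q + j, and the geometric series over j sums to 4 / 2^q.\<close>

lemma
  shows sets_trashed: "{Z. trashed G q (Collect Z)} \<in> sets coin_measure"
    and measure_trashed: "measure coin_measure {Z. trashed G q (Collect Z)} \<le> 4 / 2 ^ q"
proof -
  interpret prob_space coin_measure by (rule prob_space_coin)
  define C where "C d = {Z. covers d (Collect Z)}" for d
  define F where "F j = {d \<in> trace G (prod_encode (q, j)). cheap (prod_encode (q, j)) d}" for j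
  define W where "W j = (\<Union>d\<in>F j. C d)" for j
  have C: "C d \<in> events" for d unfolding C_def by (rule sets_covers)
  have F: "finite (F j)" for j unfolding F_def using finite_trace by simp
  have W: "W j \<in> events" for j unfolding W_def using F C by auto
  have eq: "{Z. trashed G q (Collect Z)} = (\<Union>j. W j)"
    by (auto simp: trashed_def W_def F_def C_def)
  show "{Z. trashed G q (Collect Z)} \<in> events" unfolding eq using W by auto
  have Wj: "prob (W j) \<le> (2 / 2 ^ q) * (1 / 2) ^ j" for j
  proof -
    let ?s = "prod_encode (q, j)"
    have s: "q + j \<le> ?s"
    proof -
      have "n \<le> triangle n" for n by (induction n) auto
      then show ?thesis unfolding prod_encode_def by (simp add: trans_le_add1)
    qed
    have "prob (W j) \<le> (\<Sum>d\<in>F j. prob (C d))"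
      unfolding W_def by (rule finite_measure_subadditive_finite) (use F C in auto)
    also have "\<dots> \<le> (\<Sum>d\<in>F j. 1 / 4 ^ ?s)"
      by (intro sum_mono) (auto simp: F_def C_def intro: measure_covers)
    also have "\<dots> = card (F j) / 4 ^ ?s" by simp
    also have "\<dots> \<le> (2 * 2 ^ ?s) / 4 ^ ?s"
    proof (rule divide_right_mono)
      have "card (F j) \<le> card (trace G ?s)"
        unfolding F_def by (intro card_mono finite_trace) auto
      also have "\<dots> \<le> ?s + 2" by (rule card_trace_le)
      also have "\<dots> \<le> 2 * 2 ^ ?s"
      proof -
        have "n + 2 \<le> 2 * 2 ^ n" for n :: nat by (induction n) auto
        then show ?thesis .
      qed
      finally have "real (card (F j)) \<le> real (2 * 2 ^ ?s)" unfolding of_nat_le_iff .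
      then show "real (card (F j)) \<le> 2 * 2 ^ ?s" by simp
    qed simp
    also have "\<dots> = 2 * (1 / 2) ^ ?s"
    proof -
      have "(4 :: real) ^ ?s = 2 ^ ?s * 2 ^ ?s" by (simp flip: power_mult_distrib)
      then show ?thesis by (simp add: power_divide)
    qed
    also have "\<dots> \<le> 2 * (1 / 2) ^ (q + j)"
      by (intro mult_left_mono power_decreasing s) auto
    also have "\<dots> = (2 / 2 ^ q) * (1 / 2) ^ j" by (simp add: power_add power_divide)
    finally show ?thesis .
  qed
  have geo: "(\<lambda>j. (2 / 2 ^ q) * (1 / 2 :: real) ^ j) sums (4 / 2 ^ q)"
    using sums_mult[OF geometric_sums[of "1 / 2 :: real"], of "2 / 2 ^ q"] by simp
  have sumW: "summable (\<lambda>j. prob (W j))"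
    by (rule summable_comparison_test'[OF sums_summable[OF geo], of 0])
      (simp only: real_norm_def abs_of_nonneg[OF measure_nonneg] Wj)
  have "prob (\<Union>j. W j) \<le> (\<Sum>j. prob (W j))"
    by (rule finite_measure_subadditive_countably) (use W sumW in auto)
  also have "\<dots> \<le> 4 / 2 ^ q"
    using suminf_le[OF Wj sumW sums_summable[OF geo]] sums_unique[OF geo] by simp
  finally show "prob {Z. trashed G q (Collect Z)} \<le> 4 / 2 ^ q" unfolding eq .
qed

text \<open>The number t is at once the computation time, the length of the oracle strings z and the
  stage up to which the trace is inspected; v codes the guessed string on block m. Below m0 anything
  is accepted, so that a search can succeed for every m. With \<open>d0 < t\<close> the truncation
  of an oracle to t bits decides whether d0 covers it.\<close>

definition acceptable :: "nat set \<Rightarrow> nat \<Rightarrow> nat \<Rightarrow> nat \<Rightarrow> nat \<Rightarrow> nat \<Rightarrow> nat \<Rightarrow> nat \<Rightarrow> nat \<Rightarrow> bool" where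
  "acceptable G k a q m0 d0 m t v \<longleftrightarrow> m < m0 \<or> d0 < t \<and>
    (\<forall>z<2 ^ t. covers d0 (set_decode z) \<or>
      (\<exists>j<t. \<exists>d<t. \<exists>n<t. enumerates_at G n (prod_encode (q, j)) d \<and>
        cheap (prod_encode (q, j)) d \<and> covers d (set_decode z)) \<or>
      \<not> late_error k a t (set_decode v) m (set_decode z))"

lemma decidable_in_late_error [comp_intros]:
  assumes "computable_in X n f" "computable_in X n g" "computable_in X n h" "computable_in X n i"
  shows "decidable_in X n (\<lambda>e. late_error k a (f e) (set_decode (g e)) (h e) (set_decode (i e)))"
proof -
  have "late_error k a t u m Z \<longleftrightarrow> (k + 3) * (3 * m ^ 2 + 3 * m + 1) <
    2 * (k + 1) * card {x. x < Suc m ^ 3 \<and> (m ^ 3 \<le> x \<and>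
      \<not> halts t Z a (Suc (prod_encode (x, 0))) (of_bool (x \<in> u)))}" for t u m Z
  proof -
    have "{x \<in> block m. \<not> halts t Z a (list_encode [x]) (of_bool (x \<in> u))} =
      {x. x < Suc m ^ 3 \<and> (m ^ 3 \<le> x \<and> \<not> halts t Z a (Suc (prod_encode (x, 0))) (of_bool (x \<in> u)))}"
      by (auto simp: block_def simp del: power_Suc)
    then show ?thesis by (simp only: late_error_def card_block)
  qed
  then have "decidable_in X 4 (\<lambda>e. late_error k a (e 0) (set_decode (e 1)) (e 2) (set_decode (e 3)))"
    apply (simp only:)
    apply (intro comp_intros)
                        apply simp_all
    done
  moreover have "computable_in X n ([f, g, h, i] ! j)" if "j < 4" for j
    using that assms by (auto simp: less_Suc_eq numeral_eq_Suc)
  ultimately show ?thesis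
    using computable_in_subst[of X 4 _ n "\<lambda>j. [f, g, h, i] ! j"]
    unfolding decidable_in_def by fastforce
qed

lemma decidable_in_enumerates_at' [comp_intros]:
  assumes "computable_in G n f" "computable_in G n g" "computable_in G n h"
  shows "decidable_in G n (\<lambda>e. enumerates_at G (f e) (g e) (h e))"
proof -
  have "computable_in G n ([f, g, h] ! j)" if "j < 3" for j
    using that assms by (auto simp: less_Suc_eq numeral_eq_Suc)
  with decidable_in_enumerates_at[of G] show ?thesis
    using computable_in_subst[of G 3 _ n "\<lambda>j. [f, g, h] ! j"]
    unfolding decidable_in_def by fastforce
qed

lemma decidable_in_acceptable:
  "decidable_in G 3 (\<lambda>e. acceptable G k a q m0 d0 (e 0) (e 1) (e 2))"
  unfolding acceptable_def
  apply (intro comp_intros)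
                      apply simp_all
  done

text \<open>On each block A copies the string v found by the first successful search. For an oracle
  outside both exceptional sets, the truncation to t bits must satisfy the third alternative of
  \<open>acceptable\<close>, so this string errs rarely, whatever false members the trace
  has.\<close>

lemma coarse_approximation_of_acceptable:
  assumes acc: "\<And>m. \<exists>t v. acceptable G k (program_code p) q m0 d0 m t v"
  obtains A where "A \<le>\<^sub>T G"
    "\<And>Z. total_on p Z \<Longrightarrow> \<not> covers d0 Z \<Longrightarrow> \<not> trashed G q Z \<Longrightarrow>
      density_dist A (computed_set p Z) \<le> ereal (1 / 2 + 1 / real (k + 1))"
proof -
  let ?acc = "acceptable G k (program_code p) q m0 d0"
  define r where "r m = (LEAST r. ?acc m (fst (prod_decode r)) (snd (prod_decode r)))" for m
  define b where "b x = (LEAST m. x < Suc m ^ 3)" for x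
  define A where "A = {x. x \<in> set_decode (snd (prod_decode (r (b x))))}"
  have ex: "\<exists>r. ?acc m (fst (prod_decode r)) (snd (prod_decode r))" for m
    using acc[of m] by (metis fst_conv prod_encode_inverse snd_conv)
  have r: "?acc m (fst (prod_decode (r m))) (snd (prod_decode (r m)))" for m
    unfolding r_def by (rule LeastI_ex[OF ex])
  have exb: "\<exists>m. x < Suc m ^ 3" for x
    using self_le_power[of "Suc x" 3] by (intro exI[of _ x]) simp
  have b: "b x = m" if "x \<in> block m" for x m
    unfolding b_def
  proof (rule Least_equality)
    show "x < Suc m ^ 3" using that by (simp add: block_def)
    show "m \<le> m'" if "x < Suc m' ^ 3" for m'
    proof (rule ccontr)
      assume "\<not> m \<le> m'"
      then have "Suc m' ^ 3 \<le> m ^ 3" by (intro power_mono) auto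
      with that \<open>x \<in> block m\<close> show False by (simp add: block_def)
    qed
  qed
  have "A \<le>\<^sub>T G"
  proof (rule turing_reducible_of_decidable)
    have acc3: "decidable_in G 2 (\<lambda>e. ?acc (e (Suc 0)) (fst (prod_decode (e 0))) (snd (prod_decode (e 0))))"
    proof -
      have "computable_in G 2 ([\<lambda>e. e (Suc 0), \<lambda>e. fst (prod_decode (e 0)), \<lambda>e. snd (prod_decode (e 0))] ! j)"
        if "j < 3" for j
        using that by (auto simp: less_Suc_eq numeral_eq_Suc intro!: comp_intros)
      with decidable_in_acceptable[of G k "program_code p" q m0 d0] show ?thesis
        using computable_in_subst[of G 3 _ 2
            "\<lambda>j. [\<lambda>e. e (Suc 0), \<lambda>e. fst (prod_decode (e 0)), \<lambda>e. snd (prod_decode (e 0))] ! j"]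
        unfolding decidable_in_def by fastforce
    qed
    have "computable_in G 1 (\<lambda>e. r (e 0))"
      unfolding r_def by (rule computable_in_Least) (use acc3 ex in \<open>simp_all add: numeral_2_eq_2\<close>)
    note r_comp = computable_in_subst1[OF this]
    have "computable_in G 1 (\<lambda>e. b (e 0))"
      unfolding b_def by (intro comp_intros exb) auto
    note b_comp = computable_in_subst1[OF this]
    show "decidable_in G 1 (\<lambda>e. e 0 \<in> A)"
      unfolding A_def mem_Collect_eq by (intro comp_intros r_comp b_comp) auto
  qed
  moreover have "density_dist A (computed_set p Z) \<le> ereal (1 / 2 + 1 / real (k + 1))"
    if Z: "total_on p Z" "\<not> covers d0 Z" "\<not> trashed G q Z" for Z
  proof (rule density_dist_le_blocks)
    fix m assume m: "m \<ge> m0"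
    define t v where "t = fst (prod_decode (r m))" and "v = snd (prod_decode (r m))"
    define z where "z = set_encode (Z \<inter> {..<t})"
    have dec: "set_decode z = Z \<inter> {..<t}" unfolding z_def by (rule set_encode_inverse) simp
    have "z < 2 ^ t"
    proof -
      have "z \<le> set_encode {..<t}" unfolding z_def set_encode_def
        by (intro sum_mono2) auto
      also have "\<dots> < 2 ^ t" by (simp add: set_encode_def mask_eq_sum_exp[symmetric] lessThan_def flip: mask_eq_exp_minus_1)
      finally show ?thesis .
    qed
    have restrict: "covers d (Z \<inter> {..<t}) \<longleftrightarrow> covers d Z" if "d < t" for d
      using depends_on_covers[of d t] that by (simp add: depends_on_def)
    have d0: "d0 < t" and "covers d0 (set_decode z) \<or>
      (\<exists>j<t. \<exists>d<t. \<exists>n<t. enumerates_at G n (prod_encode (q, j)) d \<and>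
        cheap (prod_encode (q, j)) d \<and> covers d (set_decode z)) \<or>
      \<not> late_error k (program_code p) t (set_decode v) m (set_decode z)"
      using r[of m] m \<open>z < 2 ^ t\<close> unfolding acceptable_def t_def[symmetric] v_def[symmetric] by auto
    then have "\<not> late_error k (program_code p) t (set_decode v) m (Z \<inter> {..<t})"
    proof (elim disjE)
      assume "covers d0 (set_decode z)"
      then show ?thesis using Z(2) restrict[OF d0] by (simp add: dec)
    next
      assume "\<exists>j<t. \<exists>d<t. \<exists>n<t. enumerates_at G n (prod_encode (q, j)) d \<and>
        cheap (prod_encode (q, j)) d \<and> covers d (set_decode z)"
      then have "trashed G q Z" unfolding trashed_def trace_def dec using restrict by blast
      with Z(3) show ?thesis by simp
    qed (simp add: dec)
    then have "\<not> late_error k (program_code p) t (set_decode v) m Z"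
      using depends_on_late_error[of t k "program_code p" "set_decode v" m] by (simp add: depends_on_def)
    then have "\<not> disagree_much k (block m) (set_decode v) (computed_set p Z)"
      by (rule late_error_sound[OF Z(1)])
    moreover have "block m \<inter> sym_diff A (computed_set p Z) =
        block m \<inter> sym_diff (set_decode v) (computed_set p Z)"
      using b by (auto simp: A_def v_def)
    ultimately show "\<not> disagree_much k (block m) A (computed_set p Z)"
      by (simp add: disagree_much_def)
  qed
  ultimately show ?thesis by (rule that)
qed

theorem coarse_approximations:
  obtains G where "one_generic G"
    "\<And>p. AE Z in coin_measure. total_on p (Collect Z) \<longrightarrow>
      (\<forall>\<^sub>F k in sequentially. \<exists>A. A \<le>\<^sub>T G \<and>
        density_dist A (computed_set p (Collect Z)) \<le> ereal (1 / 2 + 1 / real (k + 1)))"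
proof -
  interpret prob_space coin_measure by (rule prob_space_coin)
  define q where "q p k = prod_encode (program_code p, k)" for p k
  define spec where "spec p k m0 d0 dd t u \<longleftrightarrow>
    prob {Z. total_on p (Collect Z) \<and> covers d0 (Collect Z)} \<le> 1 / 2 ^ k \<and>
    (\<forall>j. cheap (prod_encode (q p k, j)) (dd j)) \<and> (\<forall>m\<ge>m0. finite (u m)) \<and>
    (\<forall>m\<ge>m0. \<forall>Z. late_error k (program_code p) (t m) (u m) m Z \<longrightarrow> covers d0 Z \<or> (\<exists>j\<le>m. covers (dd j) Z))"
    for p k m0 d0 and dd :: "nat \<Rightarrow> nat" and t :: "nat \<Rightarrow> nat" and u
  \<comment> \<open>Only the pieces dd have to be fixed for all requirements before G exists; the
    remaining data may be chosen afterwards, one program at a time.\<close>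
  have "\<exists>dd. \<exists>m0 d0 t u. spec p k m0 d0 dd t u" for p k
    by (rule late_error_cover[of p k "\<lambda>j. prod_encode (q p k, j)"]) (unfold spec_def, blast)
  then obtain dd where dd: "\<And>p k. \<exists>m0 d0 t u. spec p k m0 d0 (dd p k) t u" by metis
  define level where "level s = (let (q, j) = prod_decode s; (a, k) = prod_decode q
    in dd (THE p. program_code p = a) k j)" for s
  have level: "level (prod_encode (q p k, j)) = dd p k j" for p k j
  proof -
    have "(THE p'. program_code p' = program_code p) = p" by (auto intro: program_code_inject)
    then show ?thesis by (simp add: level_def q_def)
  qed
  obtain G where G: "one_generic G" "\<And>s. level s \<in> trace G s"
    using one_generic_tracing[of level] by blast
  have "AE Z in coin_measure. total_on p (Collect Z) \<longrightarrow>
      (\<forall>\<^sub>F k in sequentially. \<exists>A. A \<le>\<^sub>T G \<and>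
        density_dist A (computed_set p (Collect Z)) \<le> ereal (1 / 2 + 1 / real (k + 1)))" for p
  proof -
    obtain m0 d0 t u where spec: "\<And>k. spec p k (m0 k) (d0 k) (dd p k) (t k) (u k)"
      using dd[of p] by metis
    define B where "B k = {Z. total_on p (Collect Z) \<and> covers (d0 k) (Collect Z)} \<union>
      {Z. trashed G (q p k) (Collect Z)}" for k
    have cov: "{Z. total_on p (Collect Z) \<and> covers d (Collect Z)} \<in> events" for d
      using sets.Int[OF sets_total_on sets_covers] by (simp add: Collect_conj_eq)
    have B: "B k \<in> events" for k unfolding B_def using cov sets_trashed by (intro sets.Un)
    have "prob (B k) \<le> 5 * (1 / 2) ^ k" for k
    proof -
      have "prob (B k) \<le> 1 / 2 ^ k + 4 / 2 ^ q p k"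
        unfolding B_def
        by (rule order_trans[OF measure_Un_le[OF cov sets_trashed]])
          (rule add_mono, use spec[of k] in \<open>simp add: spec_def\<close>, rule measure_trashed)
      \<comment> \<open>The code \<open>q p k\<close> of the requirement is at least k, which makes
        the trashed part summable in k as well.\<close>
      also have "\<dots> \<le> 1 / 2 ^ k + 4 / 2 ^ k"
        by (intro add_left_mono divide_left_mono power_increasing)
          (auto simp: q_def le_prod_encode_2)
      finally show ?thesis by (simp add: power_divide)
    qed
    then have "summable (\<lambda>k. prob (B k))"
      by (intro summable_comparison_test'[OF summable_mult[OF summable_geometric[of "1 / 2 :: real"]], of 0])
        (auto simp: measure_nonneg)
    then have "AE Z in coin_measure. \<forall>\<^sub>F k in sequentially. Z \<in> space coin_measure - B k"
      by (intro borel_cantelli_AE1) (auto simp: B emeasure_eq_measure)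
    then show ?thesis
    proof (rule AE_mp, intro AE_I2 impI)
      fix Z assume ev: "\<forall>\<^sub>F k in sequentially. Z \<in> space coin_measure - B k"
        and tot: "total_on p (Collect Z)"
      from ev show "\<forall>\<^sub>F k in sequentially. \<exists>A. A \<le>\<^sub>T G \<and>
        density_dist A (computed_set p (Collect Z)) \<le> ereal (1 / 2 + 1 / real (k + 1))"
      proof eventually_elim
        case (elim k)
        have "\<exists>T v. acceptable G k (program_code p) (q p k) (m0 k) (d0 k) m T v" for m
        proof (cases "m < m0 k")
          case False
          then have late: "covers (d0 k) Z \<or> (\<exists>j\<le>m. covers (dd p k j) Z)"
            if "late_error k (program_code p) (t k m) (u k m) m Z" for Z
            using spec[of k] that by (auto simp: spec_def)
          have "\<exists>n. enumerates_at G n (prod_encode (q p k, j)) (dd p k j)" for j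
            using G(2)[of "prod_encode (q p k, j)"] by (simp add: level trace_def)
          then obtain n where n: "\<And>j. enumerates_at G (n j) (prod_encode (q p k, j)) (dd p k j)" by metis
          \<comment> \<open>By stage T the true time \<open>t k m\<close> has passed, and the pieces
            up to index m, the only ones relevant for block m, have appeared in the trace.\<close>
          define T where "T = Suc (d0 k + t k m + m + (\<Sum>j\<le>m. n j + dd p k j))"
          have T: "j < T" "dd p k j < T" "n j < T" if "j \<le> m" for j
            using member_le_sum[of j "{..m}" "\<lambda>j. n j + dd p k j"] that by (auto simp: T_def)
          have v: "set_decode (set_encode (u k m)) = u k m"
            using spec[of k] False by (intro set_encode_inverse) (auto simp: spec_def)
          have "acceptable G k (program_code p) (q p k) (m0 k) (d0 k) m T (set_encode (u k m))"
            unfolding acceptable_def v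
          proof (rule disjI2, intro conjI allI impI)
            show "d0 k < T" by (simp add: T_def)
            fix z
            show "covers (d0 k) (set_decode z) \<or>
                (\<exists>j<T. \<exists>d<T. \<exists>n<T. enumerates_at G n (prod_encode (q p k, j)) d \<and>
                  cheap (prod_encode (q p k, j)) d \<and> covers d (set_decode z)) \<or>
                \<not> late_error k (program_code p) T (u k m) m (set_decode z)"
            proof (cases "late_error k (program_code p) T (u k m) m (set_decode z)")
              case True
              then have "late_error k (program_code p) (t k m) (u k m) m (set_decode z)"
                by (rule late_error_antimono) (simp add: T_def)
              from late[OF this] show ?thesis
              proof
                assume "\<exists>j\<le>m. covers (dd p k j) (set_decode z)"
                then obtain j where "j \<le> m" "covers (dd p k j) (set_decode z)" by blast
                then show ?thesis using T[of j] n[of j] spec[of k] unfolding spec_def by blast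
              qed simp
            qed simp
          qed
          then show ?thesis by blast
        qed (auto simp: acceptable_def)
        then obtain A where "A \<le>\<^sub>T G"
          "\<And>Z. total_on p Z \<Longrightarrow> \<not> covers (d0 k) Z \<Longrightarrow> \<not> trashed G (q p k) Z \<Longrightarrow>
            density_dist A (computed_set p Z) \<le> ereal (1 / 2 + 1 / real (k + 1))"
          by (rule coarse_approximation_of_acceptable) blast
        then show ?case using elim tot by (auto simp: B_def)
      qed
    qed
  qed
  with G(1) show ?thesis by (rule that)
qed

lemma computed_set_of_reducible:
  assumes "B \<le>\<^sub>T Z"
  obtains p where "total_on p Z" "computed_set p Z = B"
proof -
  obtain p where p: "\<And>n. computes Z p [n] (of_bool (n \<in> B))"
    using assms unfolding turing_reducible_def of_bool_def by blast
  then have tot: "total_on p Z" unfolding total_on_def by blast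
  have "n \<in> B \<longleftrightarrow> n \<in> computed_set p Z" for n
    using p[of n] computes_computed_set[OF tot] by blast
  then have "computed_set p Z = B" by blast
  with tot show ?thesis by (rule that)
qed

lemma countable_reducible: "countable {A. A \<le>\<^sub>T G}"
proof (rule countable_subset)
  show "{A. A \<le>\<^sub>T G} \<subseteq> range (\<lambda>p. computed_set p G)"
    using computed_set_of_reducible by (metis mem_Collect_eq rangeI subsetI)
  show "countable (range (\<lambda>p. computed_set p G))" using countable_programs by simp
qed

text \<open>The oracle Z itself is used twice: as a witness at distance 1/2 for every A below G, and
  as the set whose distance from every such A is 1/2, which bounds the second supremum from
  below.\<close>

lemma degree_dist_eq_half:
  assumes eq: "\<And>A. A \<le>\<^sub>T G \<Longrightarrow> density_dist A Z = ereal (1 / 2)"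
    and approx: "\<And>p. total_on p Z \<Longrightarrow> \<forall>\<^sub>F k in sequentially. \<exists>A. A \<le>\<^sub>T G \<and>
        density_dist A (computed_set p Z) \<le> ereal (1 / 2 + 1 / real (k + 1))"
  shows "degree_dist (turing_degree G) (turing_degree Z) = ereal (1 / 2)"
proof -
  let ?h = "ereal (1 / 2)"
  have "(SUP A\<in>{A. A \<le>\<^sub>T G}. INF B\<in>{B. B \<le>\<^sub>T Z}. density_dist A B) \<le> ?h"
  proof (rule SUP_least)
    fix A assume "A \<in> {A. A \<le>\<^sub>T G}"
    then show "(INF B\<in>{B. B \<le>\<^sub>T Z}. density_dist A B) \<le> ?h"
      using eq turing_reducible_refl by (intro INF_lower2[of Z]) auto
  qed
  moreover have "(SUP B\<in>{B. B \<le>\<^sub>T Z}. INF A\<in>{A. A \<le>\<^sub>T G}. density_dist A B) \<le> ?h"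
  proof (rule SUP_least)
    fix B assume "B \<in> {B. B \<le>\<^sub>T Z}"
    then obtain p where p: "total_on p Z" "computed_set p Z = B"
      using computed_set_of_reducible by blast
    from approx[OF p(1)]
    have "\<forall>\<^sub>F k in sequentially. (INF A\<in>{A. A \<le>\<^sub>T G}. density_dist A B) \<le> ereal (1 / 2 + 1 / real (k + 1))"
      unfolding p(2) by eventually_elim (auto intro: INF_lower2)
    moreover have "(\<lambda>k. ereal (1 / 2 + 1 / real (k + 1))) \<longlonglongrightarrow> ereal (1 / 2 + 0)"
      by (intro tendsto_ereal tendsto_add tendsto_const) real_asymp
    ultimately show "(INF A\<in>{A. A \<le>\<^sub>T G}. density_dist A B) \<le> ?h"
      using tendsto_lowerbound[of "\<lambda>k. ereal (1 / 2 + 1 / real (k + 1))" ?h sequentially] by simp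
  qed
  moreover have "?h \<le> (SUP B\<in>{B. B \<le>\<^sub>T Z}. INF A\<in>{A. A \<le>\<^sub>T G}. density_dist A B)"
  proof (rule SUP_upper2[of Z])
    show "?h \<le> (INF A\<in>{A. A \<le>\<^sub>T G}. density_dist A Z)"
      by (rule INF_greatest) (simp add: eq)
  qed (simp add: turing_reducible_refl)
  ultimately show ?thesis
    unfolding degree_dist_def family_hausdorff_dist_def reducible_to_turing_degree
    by (simp add: max_def order_antisym)
qed

theorem mainTheorem3:
  shows "\<exists>G :: nat set. one_generic G \<and> attractive (turing_degree G)"
proof -
  interpret prob_space coin_measure by (rule prob_space_coin)
  obtain G where G: "one_generic G"
    "\<And>p. AE Z in coin_measure. total_on p (Collect Z) \<longrightarrow>
      (\<forall>\<^sub>F k in sequentially. \<exists>A. A \<le>\<^sub>T G \<and>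
        density_dist A (computed_set p (Collect Z)) \<le> ereal (1 / 2 + 1 / real (k + 1)))"
    by (rule coarse_approximations) blast
  have "AE Z in coin_measure. \<forall>p\<in>UNIV. total_on p (Collect Z) \<longrightarrow>
      (\<forall>\<^sub>F k in sequentially. \<exists>A. A \<le>\<^sub>T G \<and>
        density_dist A (computed_set p (Collect Z)) \<le> ereal (1 / 2 + 1 / real (k + 1)))"
    unfolding AE_ball_countable[OF countable_programs] using G(2) by blast
  moreover have "AE Z in coin_measure. \<forall>A\<in>{A. A \<le>\<^sub>T G}. density_dist A (Collect Z) = ereal (1 / 2)"
    unfolding AE_ball_countable[OF countable_reducible] using AE_density_dist_eq_half by blast
  ultimately have "AE Z in coin_measure.
      degree_dist (turing_degree G) (turing_degree {n. Z n}) = ereal (1 / 2)"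
    by eventually_elim (auto intro!: degree_dist_eq_half)
  then have ae: "AE Z in coin_measure. Z \<in> {Z. degree_dist (turing_degree G) (turing_degree {n. Z n}) = ereal (1 / 2)}"
    (is "AE Z in _. Z \<in> ?S") by simp
  interpret C: prob_space "completion coin_measure"
    by (rule prob_space.prob_space_completion[OF prob_space_coin])
  \<comment> \<open>Measurability of the event \<open>?S\<close> comes from the completion: its
    complement is null, hence measurable there.\<close>
  have "Measurable.pred (completion coin_measure) (\<lambda>Z. Z \<notin> ?S)"
    by (rule sets_completion_AE) (use ae in simp)
  then have "space (completion coin_measure) - {Z \<in> space (completion coin_measure). Z \<notin> ?S} \<in> C.events"
    by (intro sets.compl_sets predE)
  moreover have "space (completion coin_measure) - {Z \<in> space (completion coin_measure). Z \<notin> ?S} = ?S"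
    by (simp add: set_diff_eq)
  ultimately have "?S \<in> C.events" by (simp only:)
  then have "emeasure (completion coin_measure) ?S = 1"
    using AE_completion[OF ae] by (rule C.emeasure_eq_1_AE)
  with G(1) show ?thesis unfolding attractive_def by blast
qed

end
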